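(* Let $G$ be the complement of a forest. Then $G$ is non-trivially minimally tough if and only if $G$ is isomorphic to one of the graphs $P_4$, $T_{2\ell,\ell}$, or $T_{2\ell-1,\ell}$, for some integer $\ell \geq 2$.
   Context: All graphs are finite, simple, and undirected. A forest is an acyclic graph. For a graph $H$, $c(H)$ denotes the number of connected components of $H$. A set $S\subseteq V(G)$ is a separator of $G$ if $c(G-S)\ge 2$. The toughness $\tau(G)$ of a graph $G$ is the minimum of $|S|/c(G-S)$ over all separators $S$ of $G$, with $\tau(G)=\infty$ if $G$ has no separators, that is, if $G$ is complete. (Disconnected graphs have toughness $0$.) For $t\in\mathbb{R}\cup\{\infty\}$, $G$ is minimally $t$-tough if $\tau(G)=t$ and $\tau(G-e)<t$ for every edge $e$ of $G$ ($G-e$ is obtained by deleting the edge $e$). $G$ is minimally tough if it is minimally $t$-tough for some $t\in\mathbb{R}\cup\{\infty\}$. Complete graphs and edgeless graphs are trivially minimally tough; all other minimally tough graphs are called non-trivially minimally tough. $P_4$ is the four-vertex path. $T_{n,k}$ denotes the complete multipartite graph with $n$ vertices and $k$ parts whose sizes are as equal as possible (two distinct vertices are adjacent iff they belong to different parts); thus all parts of $T_{2\ell,\ell}$ have size $2$, and all parts of $T_{2\ell-1,\ell}$ have size $2$ except one of size $1$. *)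

theory Defs
  imports "Graph_Theory.Graph_Theory" "HOL-Library.Extended_Real"
begin

text \<open>
  Finite simple undirected graphs are rendered as \<^locale>\<open>pair_graph\<close>: finite, loopless,
  symmetric digraphs without parallel arcs. An edge \<open>uv\<close> is the pair of arcs \<open>(u,v)\<close>, \<open>(v,u)\<close>.
\<close>

definition delete_verts :: "'a pair_pre_digraph \<Rightarrow> 'a set \<Rightarrow> 'a pair_pre_digraph" where
  "delete_verts G S =
     \<lparr>pverts = pverts G - S, parcs = parcs G \<inter> (pverts G - S) \<times> (pverts G - S)\<rparr>"

definition delete_edge :: "'a pair_pre_digraph \<Rightarrow> 'a \<Rightarrow> 'a \<Rightarrow> 'a pair_pre_digraph" where
  "delete_edge G u v = \<lparr>pverts = pverts G, parcs = parcs G - {(u, v), (v, u)}\<rparr>"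

definition complement :: "'a pair_pre_digraph \<Rightarrow> 'a pair_pre_digraph" where
  "complement G =
     \<lparr>pverts = pverts G,
      parcs = {(u, v). u \<in> pverts G \<and> v \<in> pverts G \<and> u \<noteq> v \<and> (u, v) \<notin> parcs G}\<rparr>"

text \<open>
  The library's \<^const>\<open>forest\<close> is about directed cycles, so that already an edge, traversed
  back and forth, violates it. A cycle of an undirected graph has at least three edges.
\<close>

definition undirected_forest :: "'a pair_pre_digraph \<Rightarrow> bool" where
  "undirected_forest G \<longleftrightarrow>
     pair_graph G \<and> \<not> (\<exists>p. pre_digraph.cycle (with_proj G) p \<and> 3 \<le> length p)"

text \<open>In a symmetric digraph the strongly connected components are the connected components.\<close>

definition num_components :: "'a pair_pre_digraph \<Rightarrow> nat" where
  "num_components G = card (pre_digraph.sccs (with_proj G))"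

definition separator :: "'a pair_pre_digraph \<Rightarrow> 'a set \<Rightarrow> bool" where
  "separator G S \<longleftrightarrow> S \<subseteq> pverts G \<and> num_components (delete_verts G S) \<ge> 2"

definition toughness :: "'a pair_pre_digraph \<Rightarrow> ereal" where
  "toughness G =
     (if \<exists>S. separator G S
      then Min ((\<lambda>S. ereal (real (card S) / real (num_components (delete_verts G S))))
                  ` {S. separator G S})
      else \<infinity>)"

definition minimally_t_tough :: "ereal \<Rightarrow> 'a pair_pre_digraph \<Rightarrow> bool" where
  "minimally_t_tough t G \<longleftrightarrow>
     toughness G = t \<and> (\<forall>(u, v) \<in> parcs G. toughness (delete_edge G u v) < t)"

definition minimally_tough :: "'a pair_pre_digraph \<Rightarrow> bool" where
  "minimally_tough G \<longleftrightarrow> (\<exists>t. t \<noteq> - \<infinity> \<and> minimally_t_tough t G)"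

definition nontrivially_minimally_tough :: "'a pair_pre_digraph \<Rightarrow> bool" where
  "nontrivially_minimally_tough G \<longleftrightarrow>
     minimally_tough G \<and> \<not> K\<^bsub>card (pverts G)\<^esub> (with_proj G) \<and> parcs G \<noteq> {}"

definition path_P4 :: "nat pair_pre_digraph" where
  "path_P4 = \<lparr>pverts = {0, 1, 2, 3}, parcs = {(0, 1), (1, 0), (1, 2), (2, 1), (2, 3), (3, 2)}\<rparr>"

text \<open>
  The parts of \<open>T\<^bsub>n,k\<^esub>\<close> are the residue classes modulo \<open>k\<close> in \<open>{0..<n}\<close>; by the lemma below
  their sizes differ by at most one.
\<close>

definition turan_graph :: "nat \<Rightarrow> nat \<Rightarrow> nat pair_pre_digraph" where
  "turan_graph n k =
     \<lparr>pverts = {..<n}, parcs = {(i, j). i < n \<and> j < n \<and> i mod k \<noteq> j mod k}\<rparr>"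

lemma card_turan_part:
  assumes "r < k"
  shows "card {i \<in> pverts (turan_graph n k). i mod k = r} =
           n div k + (if r < n mod k then 1 else 0)"
proof -
  have "{i \<in> pverts (turan_graph n k). i mod k = r} =
          (\<lambda>q. q * k + r) ` {..< n div k + (if r < n mod k then 1 else 0)}" (is "?L = ?R")
  proof (intro equalityI subsetI)
    fix i assume "i \<in> ?L"
    then have i: "i < n" "i mod k = r" by (auto simp: turan_graph_def)
    have dm: "i = i div k * k + r" "n = n div k * k + n mod k" using i(2) by (metis div_mult_mod_eq)+
    have "i div k \<le> n div k" using i(1) by (simp add: div_le_mono)
    moreover have "r < n mod k" if "i div k = n div k"
      using dm i(1) that by (metis add_less_cancel_left)
    ultimately have "i div k < n div k + (if r < n mod k then 1 else 0)" by fastforce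
    then show "i \<in> ?R" using dm(1) by blast
  next
    fix i assume "i \<in> ?R"
    then obtain q where q: "i = q * k + r" "q < n div k + (if r < n mod k then 1 else 0)" by blast
    have n: "n = n div k * k + n mod k" by simp
    have "i < n"
    proof (cases "q < n div k")
      case True
      have "i < Suc q * k" using q(1) assms by simp
      also have "\<dots> \<le> n div k * k" using True by (intro mult_le_mono1) simp
      also have "\<dots> \<le> n" by simp
      finally show ?thesis .
    next
      case False
      then have "q = n div k" "r < n mod k" using q(2) by (auto split: if_splits)
      then show ?thesis using q(1) n
        by (metis add_less_cancel_left)
    qed
    then show "i \<in> ?L" using q(1) assms by (simp add: turan_graph_def)
  qed
  moreover have "inj_on (\<lambda>q. q * k + r) A" for A using assms by (auto simp: inj_on_def)
  ultimately show ?thesis by (simp add: card_image)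
qed

end

theory Submission
  imports Defs
begin

text \<open>
  Everything is read off the forest \<open>F\<close> with \<open>G = complement F\<close>; write
  \<open>n\<close> for the number of vertices and \<open>\<Delta>\<close> for the maximum degree of
  \<open>F\<close>.

  Removing \<open>S\<close> disconnects \<open>G\<close> iff the remaining vertices split into nonempty
  sets \<open>A\<close>, \<open>B\<close> that are completely joined in \<open>F\<close>. A forest has
  neither triangles nor four-cycles, so such a join is a star and never has three mutually joined parts.
  Hence every separator leaves exactly two components, the best one leaves a vertex of maximum degree
  with its neighbours, and \<open>\<tau>(G) = (n - 1 - \<Delta>) / 2\<close>
  (\<open>toughness_complement_forest\<close>).

  Deleting an edge \<open>xy\<close> from \<open>G\<close> adds it to \<open>F\<close>. For the
  toughness to drop, the added edge has to create a larger star, a triangle or a four-cycle, so that one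
  of the following holds (\<open>toughness_drop_imp\<close>): \<open>x\<close> or \<open>y\<close> has
  degree \<open>\<Delta>\<close>; or \<open>x\<close> and \<open>y\<close> have a common neighbour in
  \<open>F\<close>; or \<open>\<Delta> \<le> 2\<close> and \<open>F\<close> has a path of length three
  from \<open>x\<close> to \<open>y\<close>.

  Suppose this holds for every edge of \<open>G\<close>. If \<open>\<Delta> = 1\<close>, then two
  vertices unmatched in \<open>F\<close> would violate it, so \<open>F\<close> is a matching that misses
  at most one vertex. If \<open>\<Delta> \<ge> 2\<close>, then leaves do not have degree
  \<open>\<Delta>\<close>, so any two of them that are not adjacent are close. Two nonadjacent leaves
  exist. Either they hang on a common vertex \<open>c\<close>; then all leaves do, \<open>F\<close> is a
  spanning star, and \<open>G\<close> has toughness \<open>0\<close>, which cannot drop. Or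
  \<open>\<Delta> = 2\<close> and they are the ends of a path on four vertices, which then has to be all
  of \<open>F\<close> (\<open>forest_max_degree_2_shape\<close>). Conversely, in both kinds of forests
  every new edge enlarges a maximum star or closes a four-cycle, so that the toughness drops.

  The complement of a four-vertex path is again a four-vertex path, and the complement of a matching
  that misses at most one vertex is complete multipartite with all parts of size two but at most one of
  size one, which is \<open>T\<^bsub>2l,l\<^esub>\<close> or \<open>T\<^bsub>2l-1,l\<^esub>\<close>.
\<close>

section \<open>Simple graphs and their degrees\<close>

abbreviation neighbours :: "'a pair_pre_digraph \<Rightarrow> 'a \<Rightarrow> 'a set" where
  "neighbours F x \<equiv> parcs F `` {x}"

definition max_degree :: "'a pair_pre_digraph \<Rightarrow> nat" where
  "max_degree F = Max ((\<lambda>x. card (neighbours F x)) ` pverts F)"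

lemma pair_graph_sym: "pair_graph F \<Longrightarrow> (x, y) \<in> parcs F \<Longrightarrow> (y, x) \<in> parcs F"
  by (meson pair_graph.axioms(2) pair_pseudo_graph.axioms(2) pair_sym_digraph.arcs_symmetric)

lemma pair_graph_irrefl: "pair_graph F \<Longrightarrow> (x, x) \<notin> parcs F"
  using pair_digraph.axioms(2) pair_graph.axioms(1) pair_loopfree_digraph.pair_no_loops by fastforce

lemma pair_graph_verts:
  assumes "pair_graph F" "(x, y) \<in> parcs F"
  shows "x \<in> pverts F" "y \<in> pverts F"
proof -
  interpret pair_graph F by fact
  show "x \<in> pverts F" "y \<in> pverts F" using assms(2) by (auto dest: in_arcsD1 in_arcsD2)
qed

lemma pair_graph_finite: "pair_graph F \<Longrightarrow> finite (pverts F)"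
  by (meson pair_fin_digraph.pair_finite_verts pair_digraph_def pair_graph_def)

lemma pair_graphI:
  assumes "finite (pverts F)" "parcs F \<subseteq> pverts F \<times> pverts F"
    and "\<And>x y. (x, y) \<in> parcs F \<Longrightarrow> (y, x) \<in> parcs F" "\<And>x. (x, x) \<notin> parcs F"
  shows "pair_graph F"
proof unfold_locales
  show "finite (parcs F)" using assms(1,2) by (meson finite_SigmaI finite_subset)
  show "symmetric (with_proj F)" using assms(3) by (auto simp: symmetric_def sym_def)
qed (use assms in \<open>auto\<close>)

lemma finite_neighbours: "pair_graph F \<Longrightarrow> finite (neighbours F x)"
  by (rule finite_subset[OF _ pair_graph_finite]) (auto dest: pair_graph_verts)

lemma degree_le_max_degree:
  assumes "pair_graph F" shows "card (neighbours F x) \<le> max_degree F"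
proof (cases "x \<in> pverts F")
  case True
  then show ?thesis using pair_graph_finite[OF assms] by (auto simp: max_degree_def)
next
  case False
  then have "neighbours F x = {}" using pair_graph_verts[OF assms] by auto
  then show ?thesis by simp
qed

lemma max_degree_attained:
  assumes "pair_graph F" "pverts F \<noteq> {}"
  obtains x where "x \<in> pverts F" "card (neighbours F x) = max_degree F"
proof -
  have "max_degree F \<in> (\<lambda>x. card (neighbours F x)) ` pverts F"
    unfolding max_degree_def using assms pair_graph_finite by (intro Max_in) auto
  then show ?thesis using that by auto
qed

lemma max_degree_pos:
  assumes "pair_graph F" "parcs F \<noteq> {}" shows "max_degree F \<ge> 1"
proof -
  obtain x y where "(x, y) \<in> parcs F" using assms(2) by auto
  then have "neighbours F x \<noteq> {}" by auto
  then have "card (neighbours F x) \<ge> 1"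
    using finite_neighbours[OF assms(1)] by (simp add: Suc_le_eq card_gt_0_iff)
  then show ?thesis using degree_le_max_degree[OF assms(1)] le_trans by blast
qed

section \<open>Leaves, triangles and joins in forests\<close>

lemma forest_pair_graph: "undirected_forest F \<Longrightarrow> pair_graph F"
  by (simp add: undirected_forest_def)

text \<open>
  Cycles are defined through lists of arcs, whereas a longest path is easier to handle as a list of
  vertices; such a list determines the arcs between consecutive vertices.
\<close>

lemma walk_of_vertex_list:
  assumes "xs \<noteq> []" "successively (\<lambda>x y. (x, y) \<in> parcs F) xs"
  shows "\<exists>p. set p \<subseteq> parcs F \<and> pcas (hd xs) p (last xs) \<and> pawalk_verts (hd xs) p = xs"
  using assms
proof (induction xs rule: induct_list012)
  case (2 x)
  show ?case by (rule exI[of _ "[]"]) auto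
next
  case (3 x y zs)
  then obtain p where "set p \<subseteq> parcs F" "pcas y p (last (y # zs))" "pawalk_verts y p = y # zs"
    by auto
  then show ?case using 3 by (intro exI[of _ "(x, y) # p"]) auto
qed auto

lemma cycle_of_vertex_list:
  assumes "successively (\<lambda>x y. (x, y) \<in> parcs F) xs" "(last xs, hd xs) \<in> parcs F"
    and "distinct xs" "3 \<le> length xs" "set xs \<subseteq> pverts F"
  shows "\<exists>p. pre_digraph.cycle (with_proj F) p \<and> 3 \<le> length p"
proof -
  have ne: "xs \<noteq> []" using assms(4) by auto
  have "successively (\<lambda>x y. (x, y) \<in> parcs F) (xs @ [hd xs])"
    using assms(1,2) ne by (simp add: successively_append_iff)
  then obtain p where p: "set p \<subseteq> parcs F" "pcas (hd xs) p (hd xs)"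
      "pawalk_verts (hd xs) p = xs @ [hd xs]"
    using walk_of_vertex_list[of "xs @ [hd xs]" F] ne by auto
  have "length (pawalk_verts u q) = Suc (length q)" for u :: 'a and q
    by (induction q arbitrary: u) auto
  from this[of "hd xs" p] have "length p = length xs" using p(3) by simp
  moreover have "distinct (tl (xs @ [hd xs]))" using assms(3) ne by (cases xs) auto
  moreover have "hd xs \<in> pverts F" using ne assms(5) by auto
  ultimately show ?thesis using p assms(4)
    by (auto simp: pre_digraph.cycle_def pre_digraph.awalk_def awalk_verts_with_proj_eq
        cas_with_proj_eq intro!: exI[of _ p])
qed

text \<open>
  The first vertex of a longest path inside \<open>W\<close> cannot have two neighbours in
  \<open>W\<close>: both would lie on the path, and the one farther along it would close a cycle. This
  is the only place where acyclicity enters; all further properties of forests are derived from this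
  one.
\<close>

lemma forest_degenerate:
  assumes "undirected_forest F" "W \<subseteq> pverts F" "W \<noteq> {}"
  shows "\<exists>w\<in>W. \<forall>y\<in>W. \<forall>z\<in>W. (w, y) \<in> parcs F \<longrightarrow> (w, z) \<in> parcs F \<longrightarrow> y = z"
proof (rule ccontr)
  assume "\<not> ?thesis"
  then have two: "\<exists>y\<in>W. \<exists>z\<in>W. (w, y) \<in> parcs F \<and> (w, z) \<in> parcs F \<and> y \<noteq> z" if "w \<in> W" for w
    using that by blast
  have F: "pair_graph F" using assms(1) by (rule forest_pair_graph)
  have fin: "finite W" using assms(2) pair_graph_finite[OF F] finite_subset by blast
  define P where "P xs \<longleftrightarrow> distinct xs \<and> xs \<noteq> [] \<and> set xs \<subseteq> W \<and>
    successively (\<lambda>x y. (x, y) \<in> parcs F) xs" for xs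
  obtain w where "w \<in> W" using assms(3) by auto
  then have "P [w]" by (auto simp: P_def)
  moreover have "length xs < Suc (card W)" if "P xs" for xs
    using that card_mono[OF fin, of "set xs"] distinct_card[of xs] by (auto simp: P_def)
  ultimately obtain xs where xs: "P xs" and max: "\<And>ys. P ys \<Longrightarrow> length ys \<le> length xs"
    using ex_has_greatest_nat[of P "[w]" length "Suc (card W)"] by blast
  obtain v ys where v: "xs = v # ys" using xs by (cases xs) (auto simp: P_def)
  have on_path: "y \<in> set ys" if "y \<in> W" "(v, y) \<in> parcs F" for y
  proof (rule ccontr)
    assume "y \<notin> set ys"
    moreover have "y \<noteq> v" using that pair_graph_irrefl[OF F] by auto
    ultimately have "P (y # xs)"
      using xs that pair_graph_sym[OF F] by (auto simp: P_def v)
    then show False using max by fastforce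
  qed
  \<comment> \<open>A neighbour that is not the next vertex of the path, so that the cycle has length at
    least three.\<close>
  obtain y where y: "y \<in> W" "(v, y) \<in> parcs F" "y \<noteq> hd ys"
    using two[of v] xs by (auto simp: P_def v)
  obtain as bs where ys: "ys = as @ y # bs" using on_path y split_list by fastforce
  have "as \<noteq> []" using y(3) ys by auto
  then have "\<exists>p. pre_digraph.cycle (with_proj F) p \<and> 3 \<le> length p"
    using xs y assms(2) pair_graph_sym[OF F]
    by (intro cycle_of_vertex_list[of F "v # as @ [y]"])
      (auto simp: P_def v ys successively_append_iff successively_Cons Suc_le_eq)
  then show False using assms(1) by (simp add: undirected_forest_def)
qed

text \<open>
  Two leaves are needed to exploit that leaves are close to each other; this supplies the second one. If
  the vertex given by \<open>forest_degenerate\<close> is \<open>r\<close> itself, then \<open>r\<close>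
  is removed from \<open>W\<close> and its only neighbour there, if it has one, becomes the new root. A
  vertex found in the rest is then not adjacent to \<open>r\<close>, so that putting \<open>r\<close>
  back does not change its neighbours.
\<close>

lemma forest_second_leaf:
  assumes "undirected_forest F" "W \<subseteq> pverts F" "r \<in> W" "W \<noteq> {r}"
  shows "\<exists>w\<in>W - {r}. \<forall>y\<in>W. \<forall>z\<in>W. (w, y) \<in> parcs F \<longrightarrow> (w, z) \<in> parcs F \<longrightarrow> y = z"
  using assms(2-)
proof (induction "card W" arbitrary: W r rule: less_induct)
  case less
  note F = forest_pair_graph[OF assms(1)]
  have fin: "finite W" using less.prems(1) pair_graph_finite[OF F] finite_subset by blast
  obtain w where w: "w \<in> W"
      "\<And>y z. y \<in> W \<Longrightarrow> z \<in> W \<Longrightarrow> (w, y) \<in> parcs F \<Longrightarrow> (w, z) \<in> parcs F \<Longrightarrow> y = z"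
    using forest_degenerate[OF assms(1) less.prems(1)] less.prems(2) by blast
  let ?W = "W - {r}"
  have sub: "?W \<subseteq> pverts F" "?W \<noteq> {}" using less.prems by auto
  consider "w \<noteq> r" | "w = r" "neighbours F r \<inter> W = {}"
    | s where "w = r" "s \<in> W" "(r, s) \<in> parcs F" by auto
  then show ?case
  proof cases
    case 1
    then show ?thesis using w by blast
  next
    case 2
    obtain u where "u \<in> ?W"
        "\<And>y z. y \<in> ?W \<Longrightarrow> z \<in> ?W \<Longrightarrow> (u, y) \<in> parcs F \<Longrightarrow> (u, z) \<in> parcs F \<Longrightarrow> y = z"
      using forest_degenerate[OF assms(1) sub] by blast
    moreover from this 2 have "(u, r) \<notin> parcs F" using pair_graph_sym[OF F] by blast
    ultimately show ?thesis by (intro bexI[of _ u]) blast+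
  next
    case (3 s)
    have s: "s \<in> ?W" using 3 pair_graph_irrefl[OF F] by auto
    show ?thesis
    proof (cases "?W = {s}")
      case True
      then have "W = {r, s}" using less.prems by auto
      then show ?thesis using s pair_graph_irrefl[OF F] by (intro bexI[of _ s]) auto
    next
      case False
      have "card ?W < card W" using fin less.prems(2) by (meson card_Diff1_less)
      from less.hyps[OF this sub(1) s False] obtain u where u: "u \<in> ?W" "u \<noteq> s"
          "\<And>y z. y \<in> ?W \<Longrightarrow> z \<in> ?W \<Longrightarrow> (u, y) \<in> parcs F \<Longrightarrow> (u, z) \<in> parcs F \<Longrightarrow> y = z"
        by blast
      have "(r, u) \<notin> parcs F" using w(2)[of s u] 3 u by auto
      then have "(u, r) \<notin> parcs F" using pair_graph_sym[OF F] by blast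
      then show ?thesis using u by (intro bexI[of _ u]) blast+
    qed
  qed
qed

lemma forest_no_triangle:
  assumes "undirected_forest F" "(a, b) \<in> parcs F" "(b, c) \<in> parcs F" "(a, c) \<in> parcs F"
  shows False
proof -
  note F = forest_pair_graph[OF assms(1)]
  have "{a, b, c} \<subseteq> pverts F" using assms pair_graph_verts[OF F] by blast
  from forest_degenerate[OF assms(1) this] obtain w where "w \<in> {a, b, c}" and
    w: "\<And>y z. y \<in> {a, b, c} \<Longrightarrow> z \<in> {a, b, c} \<Longrightarrow> (w, y) \<in> parcs F \<Longrightarrow> (w, z) \<in> parcs F \<Longrightarrow> y = z"
    by blast
  then consider "w = a" | "w = b" | "w = c" by blast
  then show False
    using w[of b c] w[of a c] w[of a b] assms(2-4) assms(2-4)[THEN pair_graph_sym[OF F]]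
      pair_graph_irrefl[OF F] by cases auto
qed

text \<open>
  Two vertices on either side of a join would form a four-cycle.
\<close>

lemma forest_join_is_star:
  assumes "undirected_forest F" "A \<times> B \<subseteq> parcs F" "A \<noteq> {}" "B \<noteq> {}"
  shows "(\<exists>a. A = {a}) \<or> (\<exists>b. B = {b})"
proof (rule ccontr)
  assume neg: "\<not> ?thesis"
  note F = forest_pair_graph[OF assms(1)]
  obtain a where a: "a \<in> A" using assms(3) by auto
  obtain a' where a': "a' \<in> A" "a' \<noteq> a" using neg a by blast
  obtain b where b: "b \<in> B" using assms(4) by auto
  obtain b' where b': "b' \<in> B" "b' \<noteq> b" using neg b by blast
  have e: "(a, b) \<in> parcs F" "(a, b') \<in> parcs F" "(a', b) \<in> parcs F" "(a', b') \<in> parcs F"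
    using a a' b b' assms(2) by auto
  note e' = e[THEN pair_graph_sym[OF F]]
  have "{a, a', b, b'} \<subseteq> pverts F" using e pair_graph_verts[OF F] by blast
  from forest_degenerate[OF assms(1) this] obtain w where "w \<in> {a, a', b, b'}" and
    w: "\<And>y z. y \<in> {a, a', b, b'} \<Longrightarrow> z \<in> {a, a', b, b'} \<Longrightarrow> (w, y) \<in> parcs F \<Longrightarrow> (w, z) \<in> parcs F \<Longrightarrow> y = z"
    by blast
  then consider "w = a" | "w = a'" | "w = b" | "w = b'" by blast
  then show False
    using w[of b b'] w[of a a'] e e' a'(2) b'(2) by cases auto
qed

section \<open>Components and toughness of a complement\<close>

lemma pair_graph_complement: "pair_graph F \<Longrightarrow> pair_graph (complement F)"
  by (rule pair_graphI) (auto simp: complement_def dest: pair_graph_finite pair_graph_sym)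

lemma pair_graph_delete_verts: "pair_graph G \<Longrightarrow> pair_graph (delete_verts G S)"
  by (rule pair_graphI)
    (auto simp: delete_verts_def dest: pair_graph_finite pair_graph_sym pair_graph_irrefl)

text \<open>
  In a symmetric digraph an arc can be traversed in both directions.
\<close>

lemma scc_closed:
  assumes "pair_graph H" "C \<in> pre_digraph.sccs_verts (with_proj H)" "(a, b) \<in> parcs H"
  shows "a \<in> C \<longleftrightarrow> b \<in> C"
proof -
  interpret pair_graph H by fact
  have "a \<rightarrow>\<^sup>*\<^bsub>with_proj H\<^esub> b" "b \<rightarrow>\<^sup>*\<^bsub>with_proj H\<^esub> a"
    using assms(3) arcs_symmetric[OF assms(3)] by auto
  then show ?thesis using assms(2) unfolding in_sccs_verts_conv_reachable by blast
qed

text \<open>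
  One component against the rest gives the partition; conversely, no walk leaves a side that has no arcs
  to the other.
\<close>

lemma num_components_ge_2_iff:
  assumes "pair_graph H"
  shows "num_components H \<ge> 2 \<longleftrightarrow>
    (\<exists>A B. A \<noteq> {} \<and> B \<noteq> {} \<and> A \<inter> B = {} \<and> A \<union> B = pverts H \<and> parcs H \<inter> A \<times> B = {})"
    (is "_ \<longleftrightarrow> ?R")
proof -
  interpret pair_graph H by fact
  have num: "num_components H = card sccs_verts"
    by (simp add: num_components_def card_sccs_verts)
  show ?thesis
  proof
    assume "num_components H \<ge> 2"
    then have "\<not> card sccs_verts \<le> Suc 0" using num by simp
    then obtain C D where CD: "C \<in> sccs_verts" "D \<in> sccs_verts" "C \<noteq> D"
      using card_le_Suc0_iff_eq[OF finite_sccs_verts] by blast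
    have "C \<noteq> {}" "D \<noteq> {}" "C \<inter> D = {}" "C \<subseteq> pverts H" "D \<subseteq> pverts H"
      using CD sccs_verts_disjoint[OF CD] sccs_verts_subsets
      by (auto simp: in_sccs_verts_conv_reachable)
    moreover have "parcs H \<inter> C \<times> (pverts H - C) = {}"
      using scc_closed[OF assms CD(1)] by auto
    ultimately show ?R by (intro exI[of _ C] exI[of _ "pverts H - C"]) auto
  next
    assume ?R
    then obtain A B where AB: "A \<noteq> {}" "B \<noteq> {}" "A \<inter> B = {}" "A \<union> B = pverts H"
      "parcs H \<inter> A \<times> B = {}" by blast
    obtain a b where ab: "a \<in> A" "b \<in> B" using AB by blast
    have "v \<in> A" if "a \<rightarrow>\<^sup>*\<^bsub>with_proj H\<^esub> v" for v
      using that
    proof (induction rule: reachable_induct)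
      case (step x y)
      then show ?case using AB in_arcsD2 by blast
    qed (use ab in auto)
    then have "\<not> a \<rightarrow>\<^sup>*\<^bsub>with_proj H\<^esub> b" using ab AB(3) by blast
    then have "b \<notin> scc_of a" by (auto simp: scc_of_def)
    moreover have "b \<in> scc_of b" using ab AB(4) by (intro in_scc_of_self) auto
    ultimately have "scc_of a \<noteq> scc_of b" by blast
    moreover have "scc_of a \<in> sccs_verts" "scc_of b \<in> sccs_verts"
      using ab AB(4) by (auto intro!: scc_of_in_sccs_verts)
    ultimately have "\<not> card sccs_verts \<le> Suc 0"
      using card_le_Suc0_iff_eq[OF finite_sccs_verts] by blast
    then show "num_components H \<ge> 2" using num by simp
  qed
qed

lemma three_components_imp_independent:
  assumes "pair_graph H" "num_components H \<ge> 3"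
  obtains a b c where "{a, b, c} \<subseteq> pverts H" "a \<noteq> b" "b \<noteq> c" "a \<noteq> c"
    "(a, b) \<notin> parcs H" "(b, c) \<notin> parcs H" "(a, c) \<notin> parcs H"
proof -
  interpret pair_graph H by fact
  have "3 \<le> card sccs_verts" using assms(2) by (simp add: num_components_def card_sccs_verts)
  then obtain \<C> where "\<C> \<subseteq> sccs_verts" "card \<C> = 3" using obtain_subset_with_card_n by metis
  then obtain A B C where C: "A \<in> sccs_verts" "B \<in> sccs_verts" "C \<in> sccs_verts"
      "A \<noteq> B" "B \<noteq> C" "A \<noteq> C"
    by (auto simp: card_3_iff)
  then obtain a b c where abc: "a \<in> A" "b \<in> B" "c \<in> C"
    by (metis ex_in_conv in_sccs_verts_conv_reachable)
  have disj: "A \<inter> B = {}" "B \<inter> C = {}" "A \<inter> C = {}"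
    using C sccs_verts_disjoint by auto
  show thesis
  proof (rule that[of a b c])
    show "{a, b, c} \<subseteq> pverts H" using abc C sccs_verts_subsets by blast
    show "a \<noteq> b" "b \<noteq> c" "a \<noteq> c" using abc disj by blast+
    show "(a, b) \<notin> parcs H" using scc_closed[OF assms(1) C(1), of a b] abc disj by blast
    show "(b, c) \<notin> parcs H" using scc_closed[OF assms(1) C(2), of b c] abc disj by blast
    show "(a, c) \<notin> parcs H" using scc_closed[OF assms(1) C(1), of a c] abc disj by blast
  qed
qed

text \<open>
  The absence of arcs between two sides of \<open>complement F\<close> means that all of them are
  present in \<open>F\<close>.
\<close>

lemma separator_complement_iff:
  assumes "pair_graph F"
  shows "separator (complement F) S \<longleftrightarrow> S \<subseteq> pverts F \<and>
    (\<exists>A B. A \<noteq> {} \<and> B \<noteq> {} \<and> A \<union> B = pverts F - S \<and> A \<times> B \<subseteq> parcs F)"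
proof -
  let ?H = "delete_verts (complement F) S"
  have H: "pair_graph ?H" by (intro pair_graph_delete_verts pair_graph_complement assms)
  have verts: "pverts ?H = pverts F - S" by (simp add: delete_verts_def complement_def)
  have arcs: "parcs ?H = {(u, v). u \<in> pverts F - S \<and> v \<in> pverts F - S \<and> u \<noteq> v \<and> (u, v) \<notin> parcs F}"
    by (auto simp: delete_verts_def complement_def)
  have "A \<inter> B = {} \<and> parcs ?H \<inter> A \<times> B = {} \<longleftrightarrow> A \<times> B \<subseteq> parcs F"
    if "A \<union> B = pverts F - S" for A B
  proof
    assume "A \<inter> B = {} \<and> parcs ?H \<inter> A \<times> B = {}"
    then show "A \<times> B \<subseteq> parcs F" using that unfolding arcs by auto
  next
    assume "A \<times> B \<subseteq> parcs F"
    then show "A \<inter> B = {} \<and> parcs ?H \<inter> A \<times> B = {}"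
      using pair_graph_irrefl[OF assms] unfolding arcs by auto
  qed
  then have "(\<exists>A B. A \<noteq> {} \<and> B \<noteq> {} \<and> A \<inter> B = {} \<and> A \<union> B = pverts F - S \<and> parcs ?H \<inter> A \<times> B = {}) \<longleftrightarrow>
      (\<exists>A B. A \<noteq> {} \<and> B \<noteq> {} \<and> A \<union> B = pverts F - S \<and> A \<times> B \<subseteq> parcs F)"
    by metis
  moreover have "pverts (complement F) = pverts F" by (simp add: complement_def)
  ultimately show ?thesis
    by (simp add: separator_def num_components_ge_2_iff[OF H] verts)
qed

text \<open>
  Representatives of three components of the complement are pairwise adjacent in \<open>F\<close>.
\<close>

lemma three_components_imp_triangle:
  assumes "pair_graph F" "num_components (delete_verts (complement F) S) \<ge> 3"
  obtains a b c where "(a, b) \<in> parcs F" "(b, c) \<in> parcs F" "(a, c) \<in> parcs F"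
proof -
  have "pair_graph (delete_verts (complement F) S)"
    by (intro pair_graph_delete_verts pair_graph_complement assms)
  from three_components_imp_independent[OF this assms(2)] show ?thesis
    using that by (auto simp: delete_verts_def complement_def)
qed

lemma finite_separators: "finite (pverts G) \<Longrightarrow> finite {S. separator G S}"
  by (rule finite_subset[of _ "Pow (pverts G)"]) (auto simp: separator_def)

lemma toughness_le:
  assumes "finite (pverts G)" "separator G S"
  shows "toughness G \<le> ereal (real (card S) / real (num_components (delete_verts G S)))"
proof -
  have "toughness G = Min ((\<lambda>S. ereal (real (card S) / real (num_components (delete_verts G S))))
                  ` {S. separator G S})"
    using assms(2) unfolding toughness_def by (subst if_P) auto
  then show ?thesis using assms(2) finite_separators[OF assms(1)] by simp
qed

lemma toughness_attained:
  assumes "finite (pverts G)" "toughness G \<noteq> \<infinity>"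
  obtains S where "separator G S"
    "toughness G = ereal (real (card S) / real (num_components (delete_verts G S)))"
proof -
  let ?R = "(\<lambda>S. ereal (real (card S) / real (num_components (delete_verts G S)))) ` {S. separator G S}"
  have ex: "\<exists>S. separator G S" using assms(2) unfolding toughness_def by argo
  then have "Min ?R \<in> ?R" using finite_separators[OF assms(1)] by (intro Min_in) auto
  then have "toughness G \<in> ?R" using ex by (simp add: toughness_def)
  then show ?thesis using that by blast
qed

lemma toughness_nonneg:
  assumes "finite (pverts G)" shows "0 \<le> toughness G"
proof (cases "toughness G = \<infinity>")
  case False
  obtain S where "toughness G = ereal (real (card S) / real (num_components (delete_verts G S)))"
    by (rule toughness_attained[OF assms False])
  then show ?thesis by simp
qed simp

lemma card_join:
  assumes "pair_graph F" "A \<times> B \<subseteq> parcs F" "A \<noteq> {}" "B \<noteq> {}"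
  shows "card (A \<union> B) = card A + card B" "A \<union> B \<subseteq> pverts F"
proof -
  show sub: "A \<union> B \<subseteq> pverts F" using assms pair_graph_verts[OF assms(1)] by blast
  then have "finite A" "finite B"
    using pair_graph_finite[OF assms(1)] by (auto intro: finite_subset)
  moreover have "A \<inter> B = {}" using assms(2) pair_graph_irrefl[OF assms(1)] by blast
  ultimately show "card (A \<union> B) = card A + card B" by (rule card_Un_disjoint)
qed

text \<open>
  A join \<open>A \<times> B\<close> in \<open>F\<close> yields the separator formed by all other
  vertices. It may leave more than two components, which only lowers the ratio.
\<close>

lemma toughness_complement_le:
  assumes "pair_graph F" "A \<times> B \<subseteq> parcs F" "A \<noteq> {}" "B \<noteq> {}"
  shows "toughness (complement F) \<le> ereal ((real (card (pverts F)) - card A - card B) / 2)"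
proof -
  let ?S = "pverts F - (A \<union> B)"
  let ?c = "num_components (delete_verts (complement F) ?S)"
  note join = card_join[OF assms]
  have fin: "finite (pverts F)" by (rule pair_graph_finite[OF assms(1)])
  have "A \<union> B = pverts F - ?S" using join(2) by auto
  then have sep: "separator (complement F) ?S"
    unfolding separator_complement_iff[OF assms(1)] using assms by blast
  have "card (A \<union> B) \<le> card (pverts F)" using join(2) fin by (rule card_mono[rotated])
  then have card: "real (card ?S) = real (card (pverts F)) - card A - card B"
    using join(1) by (simp only: card_Diff_subset[OF finite_subset[OF join(2) fin] join(2)])
  have "toughness (complement F) \<le> ereal (real (card ?S) / ?c)"
    using fin sep by (intro toughness_le) (auto simp: complement_def)
  also have "\<dots> \<le> ereal (real (card ?S) / 2)"
  proof -
    have "real (card ?S) / ?c \<le> real (card ?S) / 2"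
      using sep by (intro divide_left_mono) (auto simp: separator_def)
    then show ?thesis by simp
  qed
  finally show ?thesis using card by simp
qed

text \<open>
  Without triangles in \<open>F\<close> every separator of the complement leaves exactly two components,
  so an optimal one attains the bound of \<open>toughness_complement_le\<close>.
\<close>

lemma toughness_complement_attained:
  assumes "pair_graph F" "toughness (complement F) \<noteq> \<infinity>"
    and "\<And>a b c. (a, b) \<in> parcs F \<Longrightarrow> (b, c) \<in> parcs F \<Longrightarrow> (a, c) \<in> parcs F \<Longrightarrow> False"
  obtains A B where "A \<times> B \<subseteq> parcs F" "A \<noteq> {}" "B \<noteq> {}"
    "toughness (complement F) = ereal ((real (card (pverts F)) - card A - card B) / 2)"
proof -
  have fin: "finite (pverts F)" by (rule pair_graph_finite[OF assms(1)])
  then have "finite (pverts (complement F))" by (simp add: complement_def)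
  from toughness_attained[OF this assms(2)] obtain S where S: "separator (complement F) S"
    and tough: "toughness (complement F) =
      ereal (real (card S) / num_components (delete_verts (complement F) S))" by blast
  have "\<not> num_components (delete_verts (complement F) S) \<ge> 3"
    using three_components_imp_triangle[OF assms(1)] assms(3) by metis
  then have two: "num_components (delete_verts (complement F) S) = 2"
    using S by (simp add: separator_def)
  obtain A B where AB: "A \<noteq> {}" "B \<noteq> {}" "A \<union> B = pverts F - S" "A \<times> B \<subseteq> parcs F"
    and sub: "S \<subseteq> pverts F"
    using S unfolding separator_complement_iff[OF assms(1)] by blast
  have "card A + card B = card (pverts F) - card S"
    using card_join(1)[OF assms(1) AB(4,1,2)] AB(3) sub fin
    by (simp add: card_Diff_subset finite_subset)
  moreover have "card S \<le> card (pverts F)" using sub fin by (rule card_mono[rotated])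
  ultimately have "real (card S) = real (card (pverts F)) - card A - card B" by linarith
  then show ?thesis using that AB tough two by simp
qed

text \<open>
  All joins in a forest are stars, and the largest star sits at a vertex of maximum degree.
\<close>

lemma toughness_complement_forest:
  assumes "undirected_forest F" "parcs F \<noteq> {}"
  shows "toughness (complement F) = ereal ((real (card (pverts F)) - 1 - max_degree F) / 2)"
proof (rule antisym)
  note F = forest_pair_graph[OF assms(1)]
  have "pverts F \<noteq> {}" using assms(2) pair_graph_verts[OF F] by auto
  then obtain x where x: "card (neighbours F x) = max_degree F"
    using max_degree_attained[OF F] by blast
  have "neighbours F x \<noteq> {}" using x max_degree_pos[OF F assms(2)] by (metis card.empty not_one_le_zero)
  then show le: "toughness (complement F) \<le> ereal ((real (card (pverts F)) - 1 - max_degree F) / 2)"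
  proof -
    have "toughness (complement F)
        \<le> ereal ((real (card (pverts F)) - card {x} - card (neighbours F x)) / 2)"
      using \<open>neighbours F x \<noteq> {}\<close> by (intro toughness_complement_le[OF F]) auto
    then show ?thesis by (simp only: x card.insert_remove finite.emptyI) simp
  qed
  have "toughness (complement F) \<noteq> \<infinity>" using le by auto
  from toughness_complement_attained[OF F this] forest_no_triangle[OF assms(1)]
  obtain A B where AB: "A \<times> B \<subseteq> parcs F" "A \<noteq> {}" "B \<noteq> {}"
    and tough: "toughness (complement F) = ereal ((real (card (pverts F)) - card A - card B) / 2)"
    by metis
  have "card A + card B \<le> 1 + max_degree F"
    using forest_join_is_star[OF assms(1) AB]
  proof
    assume "\<exists>a. A = {a}"
    then obtain a where a: "A = {a}" by blast
    then have "B \<subseteq> neighbours F a" using AB(1) by auto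
    then have "card B \<le> max_degree F"
      using card_mono[OF finite_neighbours[OF F]] degree_le_max_degree[OF F] le_trans by blast
    then show ?thesis using a by simp
  next
    assume "\<exists>b. B = {b}"
    then obtain b where b: "B = {b}" by blast
    then have "A \<subseteq> neighbours F b" using AB(1) pair_graph_sym[OF F] by auto
    then have "card A \<le> max_degree F"
      using card_mono[OF finite_neighbours[OF F]] degree_le_max_degree[OF F] le_trans by blast
    then show ?thesis using b by simp
  qed
  then show "ereal ((real (card (pverts F)) - 1 - max_degree F) / 2) \<le> toughness (complement F)"
    unfolding tough by simp
qed

section \<open>Deleting an edge of the complement\<close>

definition add_edge :: "'a pair_pre_digraph \<Rightarrow> 'a \<Rightarrow> 'a \<Rightarrow> 'a pair_pre_digraph" where
  "add_edge F x y = \<lparr>pverts = pverts F, parcs = parcs F \<union> {(x, y), (y, x)}\<rparr>"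

lemma delete_edge_complement: "delete_edge (complement F) x y = complement (add_edge F x y)"
  by (auto simp: delete_edge_def complement_def add_edge_def)

lemma delete_edge_commute: "delete_edge G x y = delete_edge G y x"
  by (auto simp: delete_edge_def)

lemma pair_graph_add_edge:
  assumes "pair_graph F" "x \<in> pverts F" "y \<in> pverts F" "x \<noteq> y"
  shows "pair_graph (add_edge F x y)"
  using assms pair_graph_verts[OF assms(1)] pair_graph_finite[OF assms(1)]
    pair_graph_sym[OF assms(1)] pair_graph_irrefl[OF assms(1)]
  by (intro pair_graphI) (auto simp: add_edge_def)

lemma card_neighbours_add_edge:
  assumes "pair_graph F" "card (neighbours (add_edge F x y) a) > max_degree F"
  shows "(a = x \<or> a = y) \<and> card (neighbours F a) = max_degree F"
proof -
  have mem: "a = x \<or> a = y"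
  proof (rule ccontr)
    assume "\<not> (a = x \<or> a = y)"
    then have "neighbours (add_edge F x y) a = neighbours F a" by (auto simp: add_edge_def)
    then show False using assms(2) degree_le_max_degree[OF assms(1), of a] by simp
  qed
  have fin: "finite (neighbours F a)" by (rule finite_neighbours[OF assms(1)])
  have "neighbours (add_edge F x y) a \<subseteq> insert (if a = x then y else x) (neighbours F a)"
    by (auto simp: add_edge_def)
  then have "card (neighbours (add_edge F x y) a) \<le> card (insert (if a = x then y else x) (neighbours F a))"
    using fin by (intro card_mono) auto
  also have "\<dots> \<le> Suc (card (neighbours F a))" by (rule card_insert_le_m1) auto
  finally have "max_degree F \<le> card (neighbours F a)" using assms(2) by linarith
  then show ?thesis using mem degree_le_max_degree[OF assms(1), of a] by simp
qed

text \<open>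
  Without its vertex \<open>a\<close>, or without \<open>b\<close>, the join avoids the added edge and
  lies in the forest, where it is a star. So both sides have two elements, and the join is a four-cycle
  through the added edge.
\<close>

lemma thick_join_in_forest_plus_edge:
  assumes "undirected_forest F" "A \<times> B \<subseteq> parcs (add_edge F x y)" "{a, b} = {x, y}" "x \<noteq> y"
    and "a \<in> A" "b \<in> B" "A \<noteq> {a}" "B \<noteq> {b}"
  shows "card A = 2 \<and> card B = 2 \<and> (\<exists>a' b'. (a, b') \<in> parcs F \<and> (b', a') \<in> parcs F \<and> (a', b) \<in> parcs F)"
proof -
  note F = forest_pair_graph[OF assms(1)]
  have eq: "{(x, y), (y, x)} = {(a, b), (b, a)}" using assms(3,4) by (auto simp: doubleton_eq_iff)
  have irr: "(u, u) \<notin> parcs (add_edge F x y)" for u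
    using pair_graph_irrefl[OF F] assms(4) by (auto simp: add_edge_def)
  have disj: "A \<inter> B = {}" using assms(2) irr by blast
  have inF: "(u, v) \<in> parcs F" if "u \<in> A" "v \<in> B" "u \<noteq> a \<or> v \<noteq> b" for u v
  proof -
    have "(u, v) \<in> parcs F \<union> {(a, b), (b, a)}"
      using that(1,2) assms(2) unfolding add_edge_def eq by auto
    moreover have "u \<noteq> b" using that disj assms(6) by blast
    ultimately show ?thesis using that(3) by auto
  qed
  obtain a' where a': "a' \<in> A" "a' \<noteq> a" using assms(5,7) by blast
  obtain b' where b': "b' \<in> B" "b' \<noteq> b" using assms(6,8) by blast
  have "(\<exists>u. A - {a} = {u}) \<or> (\<exists>u. B = {u})"
    using inF a' b' by (intro forest_join_is_star[OF assms(1)]) auto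
  moreover have "B \<noteq> {u}" for u using assms(6) b' by blast
  ultimately obtain u where "A - {a} = {u}" by metis
  moreover have "a' \<in> A - {a}" using a' by simp
  ultimately have "A - {a} = {a'}" by simp
  then have "A = {a, a'}" using assms(5) by auto
  then have A: "card A = 2" using a' by simp
  have "(\<exists>u. A = {u}) \<or> (\<exists>u. B - {b} = {u})"
    using inF a' b' by (intro forest_join_is_star[OF assms(1)]) auto
  moreover have "A \<noteq> {u}" for u using assms(5) a' by blast
  ultimately obtain u where "B - {b} = {u}" by metis
  moreover have "b' \<in> B - {b}" using b' by simp
  ultimately have "B - {b} = {b'}" by simp
  then have "B = {b, b'}" using assms(6) by auto
  then have B: "card B = 2" using b' by simp
  have "(a, b') \<in> parcs F" "(a', b') \<in> parcs F" "(a', b) \<in> parcs F"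
    using inF a' b' assms(5,6) by auto
  then show ?thesis using A B pair_graph_sym[OF F] by blast
qed

text \<open>
  An optimal separator of the smaller graph comes from a configuration in \<open>F\<close> plus the edge
  \<open>xy\<close>. If there are triangles, one of them uses \<open>xy\<close> and provides a common
  neighbour. Otherwise the separator leaves two components, whose join is larger than any star of
  \<open>F\<close>. If the join is a star, its centre is an end of \<open>xy\<close>, of degree
  \<open>\<Delta>\<close>; otherwise it is a four-cycle, and four exceeds \<open>1 + \<Delta>\<close>.
\<close>

lemma toughness_drop_imp:
  assumes "undirected_forest F" "parcs F \<noteq> {}"
    and "x \<in> pverts F" "y \<in> pverts F" "x \<noteq> y"
    and drop: "toughness (delete_edge (complement F) x y) < toughness (complement F)"
  shows "card (neighbours F x) = max_degree F \<or> card (neighbours F y) = max_degree F \<or>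
    (\<exists>c. (x, c) \<in> parcs F \<and> (c, y) \<in> parcs F) \<or>
    (max_degree F \<le> 2 \<and> (\<exists>a b. (x, a) \<in> parcs F \<and> (a, b) \<in> parcs F \<and> (b, y) \<in> parcs F))"
proof -
  note F = forest_pair_graph[OF assms(1)]
  let ?H = "add_edge F x y"
  have H: "pair_graph ?H" using F assms(3-5) by (rule pair_graph_add_edge)
  have drop': "toughness (complement ?H) < ereal ((real (card (pverts F)) - 1 - max_degree F) / 2)"
    using drop toughness_complement_forest[OF assms(1,2)] by (simp add: delete_edge_complement)
  show ?thesis
  proof (cases "\<exists>a b c. (a, b) \<in> parcs ?H \<and> (b, c) \<in> parcs ?H \<and> (a, c) \<in> parcs ?H")
    case True
    then obtain a b c where H3: "(a, b) \<in> parcs ?H" "(b, c) \<in> parcs ?H" "(a, c) \<in> parcs ?H" by blast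
    have mem: "(u, v) \<in> parcs ?H \<longleftrightarrow> (u, v) \<in> parcs F \<or> u = x \<and> v = y \<or> u = y \<and> v = x" for u v
      by (auto simp: add_edge_def)
    have ne: "a \<noteq> b" "b \<noteq> c" "a \<noteq> c" using H3 pair_graph_irrefl[OF H] by auto
    have not_F: "\<not> ((a, b) \<in> parcs F \<and> (b, c) \<in> parcs F \<and> (a, c) \<in> parcs F)"
      using forest_no_triangle[OF assms(1)] by blast
    then have "\<exists>c. (x, c) \<in> parcs F \<and> (c, y) \<in> parcs F"
    proof -
      from H3 not_F consider "{a, b} = {x, y}" "(b, c) \<in> parcs F \<or> {b, c} = {x, y}" "(a, c) \<in> parcs F \<or> {a, c} = {x, y}"
        | "(a, b) \<in> parcs F \<or> {a, b} = {x, y}" "{b, c} = {x, y}" "(a, c) \<in> parcs F \<or> {a, c} = {x, y}"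
        | "(a, b) \<in> parcs F \<or> {a, b} = {x, y}" "(b, c) \<in> parcs F \<or> {b, c} = {x, y}" "{a, c} = {x, y}"
        unfolding mem by fast
      then show ?thesis
        by cases (use ne pair_graph_sym[OF F] in \<open>auto simp: doubleton_eq_iff\<close>)
    qed
    then show ?thesis by blast
  next
    case False
    have "toughness (complement ?H) \<noteq> \<infinity>" using drop' by auto
    moreover have "False" if "(a, b) \<in> parcs ?H" "(b, c) \<in> parcs ?H" "(a, c) \<in> parcs ?H" for a b c
      using that False by blast
    ultimately obtain A B where AB: "A \<times> B \<subseteq> parcs ?H" "A \<noteq> {}" "B \<noteq> {}"
      and tough: "toughness (complement ?H) = ereal ((real (card (pverts ?H)) - card A - card B) / 2)"
      by (rule toughness_complement_attained[OF H])
    have card: "card A + card B > 1 + max_degree F"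
      using drop' tough by (simp add: add_edge_def field_simps)
    consider a where "A = {a}" | b where "B = {b}"
      | a b where "a \<in> A" "b \<in> B" "{a, b} = {x, y}" "A \<noteq> {a}" "B \<noteq> {b}"
    proof -
      have "(\<exists>a. A = {a}) \<or> (\<exists>b. B = {b})" if "A \<times> B \<subseteq> parcs F"
        using forest_join_is_star[OF assms(1) that AB(2,3)] .
      moreover have "\<exists>a\<in>A. \<exists>b\<in>B. {a, b} = {x, y}" if not_sub: "\<not> A \<times> B \<subseteq> parcs F"
      proof -
        obtain a b where "a \<in> A" "b \<in> B" "(a, b) \<notin> parcs F" "(a, b) \<in> parcs ?H"
          using not_sub AB(1) by blast
        then show ?thesis by (auto simp: add_edge_def)
      qed
      ultimately show ?thesis using that by metis
    qed
    then show ?thesis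
    proof cases
      case (1 a)
      then have "B \<subseteq> neighbours ?H a" using AB(1) by auto
      then have "card B \<le> card (neighbours ?H a)" using finite_neighbours[OF H] by (rule card_mono[rotated])
      then have "card (neighbours ?H a) > max_degree F" using card 1 by simp
      then show ?thesis using card_neighbours_add_edge[OF F] by blast
    next
      case (2 b)
      then have "A \<subseteq> neighbours ?H b" using AB(1) pair_graph_sym[OF H] by auto
      then have "card A \<le> card (neighbours ?H b)" using finite_neighbours[OF H] by (rule card_mono[rotated])
      then have "card (neighbours ?H b) > max_degree F" using card 2 by simp
      then show ?thesis using card_neighbours_add_edge[OF F] by blast
    next
      case (3 a b)
      from thick_join_in_forest_plus_edge[OF assms(1) AB(1) 3(3) assms(5) 3(1,2,4,5)]
      obtain a' b' where small: "card A = 2" "card B = 2"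
        and path: "(a, b') \<in> parcs F" "(b', a') \<in> parcs F" "(a', b) \<in> parcs F" by blast
      have "\<exists>a b. (x, a) \<in> parcs F \<and> (a, b) \<in> parcs F \<and> (b, y) \<in> parcs F"
        using 3(3) path path[THEN pair_graph_sym[OF F]] by (auto simp: doubleton_eq_iff)
      then show ?thesis using card small by simp
    qed
  qed
qed

text \<open>
  The new edge enlarges a maximum star by one leaf.
\<close>

lemma toughness_drop_max_degree:
  assumes "undirected_forest F" "parcs F \<noteq> {}"
    and "x \<in> pverts F" "y \<in> pverts F" "x \<noteq> y" "(x, y) \<notin> parcs F"
    and "card (neighbours F x) = max_degree F"
  shows "toughness (delete_edge (complement F) x y) < toughness (complement F)"
proof -
  note F = forest_pair_graph[OF assms(1)]
  let ?H = "add_edge F x y" and ?B = "insert y (neighbours F x)"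
  have H: "pair_graph ?H" using F assms(3-5) by (rule pair_graph_add_edge)
  have card: "card ?B = Suc (max_degree F)"
    using assms(6,7) finite_neighbours[OF F] by simp
  have "toughness (complement ?H) \<le> ereal ((real (card (pverts ?H)) - card {x} - card ?B) / 2)"
    by (intro toughness_complement_le[OF H]) (auto simp: add_edge_def)
  also have "\<dots> < ereal ((real (card (pverts F)) - 1 - max_degree F) / 2)"
    unfolding card by (simp add: add_edge_def)
  finally show ?thesis
    using toughness_complement_forest[OF assms(1,2)] by (simp add: delete_edge_complement)
qed

text \<open>
  The new edge closes a four-cycle, that is, a join of two pairs, and four vertices are more than a star
  in \<open>F\<close> contains.
\<close>

lemma toughness_drop_four_cycle:
  assumes "undirected_forest F" "max_degree F \<le> 2"
    and "x \<noteq> y" "(x, y) \<notin> parcs F"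
    and "(x, a) \<in> parcs F" "(a, b) \<in> parcs F" "(b, y) \<in> parcs F"
  shows "toughness (delete_edge (complement F) x y) < toughness (complement F)"
proof -
  note F = forest_pair_graph[OF assms(1)]
  let ?H = "add_edge F x y"
  have H: "pair_graph ?H" using pair_graph_verts[OF F] assms by (intro pair_graph_add_edge[OF F]) auto
  have "x \<noteq> b" "a \<noteq> y" using assms(4-7) pair_graph_sym[OF F] by auto
  then have card: "card {x, b} = 2" "card {a, y} = 2" by auto
  have ne: "parcs F \<noteq> {}" using assms(5) by auto
  have "toughness (complement ?H) \<le> ereal ((real (card (pverts ?H)) - card {x, b} - card {a, y}) / 2)"
    using assms(5-7) pair_graph_sym[OF F]
    by (intro toughness_complement_le[OF H]) (auto simp: add_edge_def)
  also have "\<dots> < ereal ((real (card (pverts F)) - 1 - max_degree F) / 2)"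
    unfolding card using assms(2) by (simp add: add_edge_def)
  finally show ?thesis
    using toughness_complement_forest[OF assms(1) ne] by (simp add: delete_edge_complement)
qed

text \<open>
  The complement is complete iff \<open>F\<close> has no edges; otherwise its toughness is the real
  number of \<open>toughness_complement_forest\<close>, and only the condition on the edges remains.
\<close>

lemma nontrivially_minimally_tough_complement_iff:
  assumes "undirected_forest F"
  shows "nontrivially_minimally_tough (complement F) \<longleftrightarrow>
    parcs F \<noteq> {} \<and> parcs (complement F) \<noteq> {} \<and>
    (\<forall>x\<in>pverts F. \<forall>y\<in>pverts F. x \<noteq> y \<longrightarrow> (x, y) \<notin> parcs F \<longrightarrow>
      toughness (delete_edge (complement F) x y) < toughness (complement F))"
proof -
  note F = forest_pair_graph[OF assms]
  have "K\<^bsub>card (pverts (complement F))\<^esub> (with_proj (complement F)) \<longleftrightarrow> parcs F = {}"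
  proof
    assume "K\<^bsub>card (pverts (complement F))\<^esub> (with_proj (complement F))"
    then have "(u, v) \<in> parcs (complement F)" if "u \<in> pverts F" "v \<in> pverts F" "u \<noteq> v" for u v
      using that unfolding complete_digraph_pair_def by (auto simp: complement_def)
    then have "(u, v) \<notin> parcs F" for u v
      using pair_graph_verts[OF F, of u v] pair_graph_irrefl[OF F, of u]
      by (fastforce simp: complement_def)
    then show "parcs F = {}" by auto
  next
    assume "parcs F = {}"
    then show "K\<^bsub>card (pverts (complement F))\<^esub> (with_proj (complement F))"
      using pair_graph_finite[OF F] by (auto simp: complete_digraph_pair_def complement_def)
  qed
  moreover have "minimally_tough (complement F) \<longleftrightarrow>
    (\<forall>x\<in>pverts F. \<forall>y\<in>pverts F. x \<noteq> y \<longrightarrow> (x, y) \<notin> parcs F \<longrightarrow>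
      toughness (delete_edge (complement F) x y) < toughness (complement F))" if "parcs F \<noteq> {}"
  proof -
    have "toughness (complement F) \<noteq> - \<infinity>"
      unfolding toughness_complement_forest[OF assms that] by simp
    then have "minimally_tough (complement F) \<longleftrightarrow>
      (\<forall>(x, y) \<in> parcs (complement F). toughness (delete_edge (complement F) x y) < toughness (complement F))"
      by (auto simp: minimally_tough_def minimally_t_tough_def)
    also have "\<dots> \<longleftrightarrow> (\<forall>x\<in>pverts F. \<forall>y\<in>pverts F. x \<noteq> y \<longrightarrow> (x, y) \<notin> parcs F \<longrightarrow>
      toughness (delete_edge (complement F) x y) < toughness (complement F))"
      by (auto simp: complement_def)
    finally show ?thesis .
  qed
  ultimately show ?thesis unfolding nontrivially_minimally_tough_def by blast
qed

section \<open>The forests with a minimally tough complement\<close>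

definition matching_with_at_most_one_free_vertex :: "'a pair_pre_digraph \<Rightarrow> bool" where
  "matching_with_at_most_one_free_vertex F \<longleftrightarrow>
     (\<forall>x y z. (x, y) \<in> parcs F \<longrightarrow> (x, z) \<in> parcs F \<longrightarrow> y = z) \<and>
     (\<forall>x\<in>pverts F. \<forall>y\<in>pverts F. neighbours F x = {} \<longrightarrow> neighbours F y = {} \<longrightarrow> x = y)"

definition four_vertex_path :: "'a pair_pre_digraph \<Rightarrow> 'a \<Rightarrow> 'a \<Rightarrow> 'a \<Rightarrow> 'a \<Rightarrow> bool" where
  "four_vertex_path F a b c d \<longleftrightarrow> distinct [a, b, c, d] \<and> pverts F = {a, b, c, d} \<and>
     parcs F = {(a, b), (b, a), (b, c), (c, b), (c, d), (d, c)}"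

lemma card_neighbours_le_1:
  assumes "\<And>y z. (x, y) \<in> parcs F \<Longrightarrow> (x, z) \<in> parcs F \<Longrightarrow> y = z"
  shows "card (neighbours F x) \<le> 1"
proof (cases "neighbours F x = {}")
  case False
  then obtain y where "neighbours F x = {y}" using assms by blast
  then show ?thesis by simp
qed simp

lemma max_degree_matching:
  assumes "pair_graph F" "parcs F \<noteq> {}"
    and "\<And>x y z. (x, y) \<in> parcs F \<Longrightarrow> (x, z) \<in> parcs F \<Longrightarrow> y = z"
  shows "max_degree F = 1"
proof -
  have "pverts F \<noteq> {}" using assms(2) pair_graph_verts[OF assms(1)] by auto
  then obtain x where "card (neighbours F x) = max_degree F"
    using max_degree_attained[OF assms(1)] by blast
  moreover have "card (neighbours F x) \<le> 1" using assms(3) by (rule card_neighbours_le_1)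
  ultimately show ?thesis using max_degree_pos[OF assms(1,2)] by simp
qed

text \<open>
  The hypothesis \<open>close\<close> is what \<open>toughness_drop_imp\<close> provides for two
  vertices that do not have maximum degree. As \<open>\<Delta> \<ge> 2\<close>, it applies to any two
  leaves. The bound on \<open>\<Delta>\<close> excludes the spanning star.
\<close>

lemma forest_max_degree_2_shape:
  assumes "undirected_forest F" "max_degree F \<ge> 2" "max_degree F + 2 \<le> card (pverts F)"
    and close: "\<And>x y. x \<in> pverts F \<Longrightarrow> y \<in> pverts F \<Longrightarrow> x \<noteq> y \<Longrightarrow> (x, y) \<notin> parcs F \<Longrightarrow>
      card (neighbours F x) < max_degree F \<Longrightarrow> card (neighbours F y) < max_degree F \<Longrightarrow>
      (\<exists>c. (x, c) \<in> parcs F \<and> (c, y) \<in> parcs F) \<or>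
      (max_degree F \<le> 2 \<and> (\<exists>a b. (x, a) \<in> parcs F \<and> (a, b) \<in> parcs F \<and> (b, y) \<in> parcs F))"
  shows "\<exists>a b c d. four_vertex_path F a b c d"
proof -
  note F = forest_pair_graph[OF assms(1)]
  note sym = pair_graph_sym[OF F] and irr = pair_graph_irrefl[OF F]
  note fin = pair_graph_finite[OF F] and verts = pair_graph_verts[OF F]
  \<comment> \<open>Isolated vertices count as leaves, until closeness excludes them.\<close>
  define leaf where "leaf x \<longleftrightarrow> x \<in> pverts F \<and> (\<forall>y z. (x, y) \<in> parcs F \<longrightarrow> (x, z) \<in> parcs F \<longrightarrow> y = z)" for x
  have leafD: "y = z" if "leaf x" "(x, y) \<in> parcs F" "(x, z) \<in> parcs F" for x y z
    using that by (simp add: leaf_def)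
  have close_leaves: "(\<exists>c. (x, c) \<in> parcs F \<and> (c, y) \<in> parcs F) \<or>
      (max_degree F = 2 \<and> (\<exists>a b. (x, a) \<in> parcs F \<and> (a, b) \<in> parcs F \<and> (b, y) \<in> parcs F))"
    if "leaf x" "leaf y" "x \<noteq> y" "(x, y) \<notin> parcs F" for x y
  proof -
    have "card (neighbours F u) < max_degree F" if "leaf u" for u
      using that card_neighbours_le_1[of u F] assms(2) unfolding leaf_def by fastforce
    then show ?thesis using close[of x y] that assms(2) by (auto simp: leaf_def)
  qed
  \<comment> \<open>If no edges lead into \<open>X\<close>, then the part of the forest outside
    \<open>X\<close> has a leaf of its own.\<close>
  have leaf_outside: "\<exists>u. leaf u \<and> u \<notin> X"
    if "\<not> pverts F \<subseteq> X" "\<And>u v. u \<notin> X \<Longrightarrow> v \<in> X \<Longrightarrow> (u, v) \<notin> parcs F" for X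
  proof -
    have "pverts F - X \<noteq> {}" using that(1) by auto
    from forest_degenerate[OF assms(1) _ this] obtain u where u: "u \<in> pverts F - X"
      "\<forall>y\<in>pverts F - X. \<forall>z\<in>pverts F - X. (u, y) \<in> parcs F \<longrightarrow> (u, z) \<in> parcs F \<longrightarrow> y = z" by blast
    have "y \<in> pverts F - X" if "(u, y) \<in> parcs F" for y
      using that \<open>\<And>u v. u \<notin> X \<Longrightarrow> v \<in> X \<Longrightarrow> (u, v) \<notin> parcs F\<close> u(1) verts by blast
    then show ?thesis using u unfolding leaf_def by (intro exI[of _ u]) auto
  qed
  have big: "\<not> pverts F \<subseteq> X" if "card X \<le> 3" "finite X" for X
    using that card_mono[of X "pverts F"] assms(2,3) by auto
  obtain p where p: "leaf p" using leaf_outside[of "{}"] big[of "{}"] by auto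
  have pV: "p \<in> pverts F" using p by (simp add: leaf_def)
  have "pverts F \<noteq> {p}" using big[of "{p}"] by auto
  from forest_second_leaf[OF assms(1) order.refl pV this] obtain q where q: "leaf q" "q \<noteq> p"
    using verts unfolding leaf_def by blast
  \<comment> \<open>Otherwise \<open>{p, q}\<close> is a component, and \<open>p\<close> is not close to
    a leaf outside it.\<close>
  have pq: "(p, q) \<notin> parcs F"
  proof
    assume e: "(p, q) \<in> parcs F"
    have p1: "v = q" if "(p, v) \<in> parcs F" for v using leafD[OF p that e] .
    have q1: "v = p" if "(q, v) \<in> parcs F" for v using leafD[OF q(1) that sym[OF e]] .
    have closed: "(u, v) \<notin> parcs F" if "u \<notin> {p, q}" "v \<in> {p, q}" for u v
      using that p1 q1 sym[of u v] by auto
    have "\<not> pverts F \<subseteq> {p, q}" using q(2) by (intro big) auto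
    from leaf_outside[OF this closed] obtain u where u: "leaf u" "u \<notin> {p, q}" by blast
    have "(p, u) \<notin> parcs F" using p1 u by auto
    with close_leaves[OF p u(1)] u(2) show False using p1 q1 by auto
  qed
  show ?thesis
  proof (cases "\<exists>c. (p, c) \<in> parcs F \<and> (c, q) \<in> parcs F")
    case True
    then obtain c where c: "(p, c) \<in> parcs F" "(q, c) \<in> parcs F" using sym by blast
    have p1: "v = c" if "(p, v) \<in> parcs F" for v using leafD[OF p that c(1)] .
    have q1: "v = c" if "(q, v) \<in> parcs F" for v using leafD[OF q(1) that c(2)] .
    \<comment> \<open>All leaves hang on \<open>c\<close>: a path \<open>p c b w\<close> would force
      \<open>\<Delta> = 2\<close>, while \<open>c\<close> is adjacent to \<open>p\<close>,
      \<open>q\<close>, \<open>b\<close>.\<close>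
    have hang: "(w, c) \<in> parcs F" if w: "leaf w" for w
    proof (rule ccontr)
      assume n: "(w, c) \<notin> parcs F"
      have "w \<noteq> p" "w \<noteq> q" using n c by auto
      show False
      proof (cases "w = c")
        case True
        then show False using leafD[OF w, of p q] c[THEN sym] q(2) by simp
      next
        case False
        then have "(p, w) \<notin> parcs F" using p1 by auto
        from close_leaves[OF p w \<open>w \<noteq> p\<close>[symmetric] this] show False
        proof (elim disjE conjE exE)
          fix d assume "(p, d) \<in> parcs F" "(d, w) \<in> parcs F"
          then show False using p1 n sym by blast
        next
          fix a b assume deg: "max_degree F = 2" and ab: "(p, a) \<in> parcs F" "(a, b) \<in> parcs F" "(b, w) \<in> parcs F"
          have "a = c" using p1 ab by blast
          have "b \<noteq> p" "b \<noteq> q" using ab p1 q1 False by auto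
          then have "card {p, q, b} = 3" using q(2) by auto
          moreover have "{p, q, b} \<subseteq> neighbours F c" using c[THEN sym] ab \<open>a = c\<close> by auto
          ultimately have "3 \<le> card (neighbours F c)"
            using card_mono[OF finite_neighbours[OF F], of "{p, q, b}" c] by simp
          then show False using deg degree_le_max_degree[OF F, of c] by simp
        qed
      qed
    qed
    let ?X = "{w. leaf w \<and> (w, c) \<in> parcs F}"
    let ?Y = "pverts F - ?X"
    have cY: "c \<in> ?Y" using irr verts c by auto
    \<comment> \<open>The vertices of \<open>?X\<close> have no neighbours but \<open>c\<close>. So a
      leaf of the remaining forest other than \<open>c\<close> would be a leaf of \<open>F\<close>
      outside \<open>?X\<close>.\<close>
    have "?Y = {c}"
    proof (rule ccontr)
      assume "?Y \<noteq> {c}"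
      from forest_second_leaf[OF assms(1) _ cY this] obtain w where w: "w \<in> ?Y - {c}"
        and uniq: "\<And>y z. y \<in> ?Y \<Longrightarrow> z \<in> ?Y \<Longrightarrow> (w, y) \<in> parcs F \<Longrightarrow> (w, z) \<in> parcs F \<Longrightarrow> y = z" by blast
      have inY: "v \<in> ?Y" if "(w, v) \<in> parcs F" for v
        using that w sym[OF that] verts leafD by blast
      have "y = z" if "(w, y) \<in> parcs F" "(w, z) \<in> parcs F" for y z
        using uniq[OF inY[OF that(1)] inY[OF that(2)] that] .
      then have "leaf w" using w by (simp add: leaf_def)
      then show False using hang w by simp
    qed
    then have "pverts F - {c} \<subseteq> neighbours F c" using sym by blast
    then have "card (pverts F - {c}) \<le> card (neighbours F c)"
      using finite_neighbours[OF F] by (rule card_mono[rotated])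
    moreover have "card (pverts F - {c}) = card (pverts F) - 1" using cY by (simp add: card_Diff_singleton)
    ultimately have False using degree_le_max_degree[OF F, of c] assms(3) by simp
    then show ?thesis ..
  next
    case False
    with close_leaves[OF p q(1) q(2)[symmetric] pq] obtain a b where deg: "max_degree F = 2"
      and ab: "(p, a) \<in> parcs F" "(a, b) \<in> parcs F" "(b, q) \<in> parcs F" by blast
    have dist: "distinct [p, a, b, q]"
      using ab pq q(2) False irr sym by auto
    \<comment> \<open>As \<open>\<Delta> = 2\<close>, this leaves the path \<open>p a b q\<close>
      without edges to the outside.\<close>
    have two: "neighbours F v = {u, w}" if "(v, u) \<in> parcs F" "(v, w) \<in> parcs F" "u \<noteq> w" for u v w
    proof (rule card_seteq[symmetric])
      show "card (neighbours F v) \<le> card {u, w}" using that deg degree_le_max_degree[OF F, of v] by simp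
    qed (use that finite_neighbours[OF F] in auto)
    have nb_p: "(p, v) \<in> parcs F \<longleftrightarrow> v = a" for v
      using leafD[OF p _ ab(1), of v] ab(1) by blast
    have nb_q: "(q, v) \<in> parcs F \<longleftrightarrow> v = b" for v
      using leafD[OF q(1) _ sym[OF ab(3)], of v] sym[OF ab(3)] by blast
    have Na: "neighbours F a = {p, b}" using two[of a p b] ab sym dist by auto
    have Nb: "neighbours F b = {a, q}" using two[of b a q] ab sym dist by auto
    have "(a, v) \<in> parcs F \<longleftrightarrow> v = p \<or> v = b" "(b, v) \<in> parcs F \<longleftrightarrow> v = a \<or> v = q" for v
      using Na Nb by blast+
    note nb = nb_p nb_q this
    let ?X = "{p, a, b, q}"
    have "pverts F \<subseteq> ?X"
    proof (rule ccontr)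
      assume outside: "\<not> pverts F \<subseteq> ?X"
      have closed: "(u, v) \<notin> parcs F" if "u \<notin> ?X" "v \<in> ?X" for u v
        using that sym[of u v] nb by auto
      from leaf_outside[OF outside closed] obtain u where u: "leaf u" "u \<notin> ?X" by blast
      have "(p, u) \<notin> parcs F" using u(2) nb by auto
      with close_leaves[OF p u(1)] u(2) show False using nb by auto
    qed
    moreover have "?X \<subseteq> pverts F" using ab verts by blast
    ultimately have V: "pverts F = ?X" by blast
    have arcs: "(u, v) \<in> parcs F \<longleftrightarrow> (u, v) \<in> {(p, a), (a, p), (a, b), (b, a), (b, q), (q, b)}" for u v
    proof (cases "u \<in> ?X")
      case True
      then show ?thesis using nb dist by auto
    next
      case False
      then have "(u, v) \<notin> parcs F" using verts V by blast
      then show ?thesis using False by auto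
    qed
    have "parcs F = {(p, a), (a, p), (a, b), (b, a), (b, q), (q, b)}"
    proof (rule set_eqI)
      fix e
      show "e \<in> parcs F \<longleftrightarrow> e \<in> {(p, a), (a, p), (a, b), (b, a), (b, q), (q, b)}"
        by (cases e) (simp only: arcs)
    qed
    then have "four_vertex_path F p a b q" unfolding four_vertex_path_def using dist V by simp
    then show ?thesis by blast
  qed
qed

lemma nontrivially_minimally_tough_imp_shape:
  assumes "undirected_forest F" "nontrivially_minimally_tough (complement F)"
  shows "matching_with_at_most_one_free_vertex F \<or> (\<exists>a b c d. four_vertex_path F a b c d)"
proof -
  note F = forest_pair_graph[OF assms(1)]
  have ne: "parcs F \<noteq> {}" "parcs (complement F) \<noteq> {}" and
    drop: "\<And>x y. x \<in> pverts F \<Longrightarrow> y \<in> pverts F \<Longrightarrow> x \<noteq> y \<Longrightarrow> (x, y) \<notin> parcs F \<Longrightarrow>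
      toughness (delete_edge (complement F) x y) < toughness (complement F)"
    using assms(2) unfolding nontrivially_minimally_tough_complement_iff[OF assms(1)] by auto
  have close: "card (neighbours F x) = max_degree F \<or> card (neighbours F y) = max_degree F \<or>
    (\<exists>c. (x, c) \<in> parcs F \<and> (c, y) \<in> parcs F) \<or>
    (max_degree F \<le> 2 \<and> (\<exists>a b. (x, a) \<in> parcs F \<and> (a, b) \<in> parcs F \<and> (b, y) \<in> parcs F))"
    if "x \<in> pverts F" "y \<in> pverts F" "x \<noteq> y" "(x, y) \<notin> parcs F" for x y
    using toughness_drop_imp[OF assms(1) ne(1) that(1-3) drop[OF that]] .
  show ?thesis
  proof (cases "max_degree F \<ge> 2")
    case True
    obtain x y where xy: "x \<in> pverts F" "y \<in> pverts F" "x \<noteq> y" "(x, y) \<notin> parcs F"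
      using ne(2) by (auto simp: complement_def)
    have "pverts (delete_edge (complement F) x y) = pverts F"
      by (simp add: delete_edge_def complement_def)
    \<comment> \<open>A toughness that drops was positive, which bounds \<open>\<Delta>\<close>.\<close>
    then have "0 \<le> toughness (delete_edge (complement F) x y)"
      using toughness_nonneg pair_graph_finite[OF F] by metis
    also have "\<dots> < toughness (complement F)" using drop[OF xy] .
    finally have "max_degree F + 2 \<le> card (pverts F)"
      unfolding toughness_complement_forest[OF assms(1) ne(1)] by simp
    then have "\<exists>a b c d. four_vertex_path F a b c d"
      using close by (intro forest_max_degree_2_shape[OF assms(1) True]) fastforce+
    then show ?thesis ..
  next
    case False
    then have one: "max_degree F = 1" using max_degree_pos[OF F ne(1)] by simp
    have uniq: "y = z" if "(x, y) \<in> parcs F" "(x, z) \<in> parcs F" for x y z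
    proof -
      have "card (neighbours F x) \<le> Suc 0" using degree_le_max_degree[OF F, of x] one by simp
      then show ?thesis using that card_le_Suc0_iff_eq[OF finite_neighbours[OF F]] by auto
    qed
    have "x = y" if "x \<in> pverts F" "y \<in> pverts F" "neighbours F x = {}" "neighbours F y = {}" for x y
    proof (rule ccontr)
      assume "x \<noteq> y"
      moreover have "(x, v) \<notin> parcs F" for v using that(3) by blast
      ultimately show False using close[OF that(1,2)] that(3,4) one by simp
    qed
    then show ?thesis using uniq unfolding matching_with_at_most_one_free_vertex_def by blast
  qed
qed

text \<open>
  Every matched vertex has maximum degree, and of two distinct vertices at least one is matched.
\<close>

lemma matching_imp_nontrivially_minimally_tough:
  assumes "undirected_forest F" "matching_with_at_most_one_free_vertex F"
    and "parcs F \<noteq> {}" "parcs (complement F) \<noteq> {}"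
  shows "nontrivially_minimally_tough (complement F)"
proof -
  note F = forest_pair_graph[OF assms(1)]
  have uniq: "\<And>x y z. (x, y) \<in> parcs F \<Longrightarrow> (x, z) \<in> parcs F \<Longrightarrow> y = z"
    and free: "\<And>x y. x \<in> pverts F \<Longrightarrow> y \<in> pverts F \<Longrightarrow> neighbours F x = {} \<Longrightarrow> neighbours F y = {} \<Longrightarrow> x = y"
    using assms(2) unfolding matching_with_at_most_one_free_vertex_def by blast+
  have one: "max_degree F = 1" using F assms(3) uniq by (rule max_degree_matching)
  have full: "card (neighbours F x) = max_degree F" if "neighbours F x \<noteq> {}" for x
    using that degree_le_max_degree[OF F, of x] finite_neighbours[OF F, of x] one
    by (metis Suc_leI card_gt_0_iff le_antisym One_nat_def)
  have "toughness (delete_edge (complement F) x y) < toughness (complement F)"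
    if xy: "x \<in> pverts F" "y \<in> pverts F" "x \<noteq> y" "(x, y) \<notin> parcs F" for x y
  proof (cases "neighbours F x = {}")
    case False
    show ?thesis using toughness_drop_max_degree[OF assms(1,3) xy full[OF False]] .
  next
    case True
    then have "neighbours F y \<noteq> {}" using free xy by blast
    then show ?thesis
      using toughness_drop_max_degree[OF assms(1,3) xy(2,1) xy(3)[symmetric] _ full] xy(4)
        pair_graph_sym[OF F] by (subst delete_edge_commute) blast
  qed
  then show ?thesis
    unfolding nontrivially_minimally_tough_complement_iff[OF assms(1)] using assms(3,4) by blast
qed

text \<open>
  Every nonadjacent pair of the path contains an inner vertex, which has maximum degree, or consists of
  the two ends, which are joined by a path of length three.
\<close>

lemma four_vertex_path_imp_nontrivially_minimally_tough:
  assumes "undirected_forest F" "four_vertex_path F a b c d"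
  shows "nontrivially_minimally_tough (complement F)"
proof -
  note F = forest_pair_graph[OF assms(1)]
  have dist: "distinct [a, b, c, d]" and V: "pverts F = {a, b, c, d}"
    and E: "parcs F = {(a, b), (b, a), (b, c), (c, b), (c, d), (d, c)}"
    using assms(2) unfolding four_vertex_path_def by auto
  have ne: "parcs F \<noteq> {}" using E by auto
  have "(a, c) \<in> parcs (complement F)" using dist by (auto simp: complement_def V E)
  then have ne': "parcs (complement F) \<noteq> {}" by auto
  have N: "neighbours F a = {b}" "neighbours F b = {a, c}" "neighbours F c = {b, d}" "neighbours F d = {c}"
    using dist unfolding E by auto
  have "card (neighbours F a) = 1" "card (neighbours F b) = 2" "card (neighbours F c) = 2"
      "card (neighbours F d) = 1"
    unfolding N using dist by auto
  moreover from this have two: "max_degree F = 2" unfolding max_degree_def V by simp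
  ultimately have full: "card (neighbours F b) = max_degree F" "card (neighbours F c) = max_degree F"
    by auto
  have drop: "toughness (delete_edge (complement F) x y) < toughness (complement F)"
    if xy: "x \<in> pverts F" "y \<in> pverts F" "x \<noteq> y" "(x, y) \<notin> parcs F" and "x \<in> {b, c} \<or> x = a \<and> y = d" for x y
    using that(5)
  proof
    assume "x \<in> {b, c}"
    then show ?thesis using toughness_drop_max_degree[OF assms(1) ne xy] full by auto
  next
    assume "x = a \<and> y = d"
    then show ?thesis using toughness_drop_four_cycle[OF assms(1) _ xy(3,4), of b c] two E by simp
  qed
  have "toughness (delete_edge (complement F) x y) < toughness (complement F)"
    if xy: "x \<in> pverts F" "y \<in> pverts F" "x \<noteq> y" "(x, y) \<notin> parcs F" for x y
  proof -
    have "(y, x) \<notin> parcs F" using xy(4) pair_graph_sym[OF F] by blast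
    moreover have "x \<in> {b, c} \<or> x = a \<and> y = d \<or> y \<in> {b, c} \<or> y = a \<and> x = d"
      using xy(1-3) unfolding V by auto
    ultimately show ?thesis
      using drop[OF xy] drop[OF xy(2,1) xy(3)[symmetric]] delete_edge_commute[of "complement F" x y] by auto
  qed
  then show ?thesis
    unfolding nontrivially_minimally_tough_complement_iff[OF assms(1)] using ne ne' by blast
qed

section \<open>Recognising the isomorphism types\<close>

text \<open>
  For pair graphs the arc map of an isomorphism is determined by its vertex map.
\<close>

lemma digraph_iso_with_proj_iff:
  assumes "pair_graph G" "pair_graph H"
  shows "digraph_iso (with_proj G) (with_proj H) \<longleftrightarrow>
    (\<exists>f. bij_betw f (pverts G) (pverts H) \<and>
      (\<forall>u\<in>pverts G. \<forall>v\<in>pverts G. (u, v) \<in> parcs G \<longleftrightarrow> (f u, f v) \<in> parcs H))"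
    (is "_ \<longleftrightarrow> (\<exists>f. ?iso f)")
proof
  assume "digraph_iso (with_proj G) (with_proj H)"
  then obtain h where h: "pre_digraph.digraph_isomorphism (with_proj G) h"
    and eq: "with_proj H = app_iso h (with_proj G)" unfolding digraph_iso_def by blast
  let ?f = "iso_verts h"
  have verts: "pverts H = ?f ` pverts G" and arcs: "parcs H = iso_arcs h ` parcs G"
    and "fst = iso_tail h" and "snd = iso_head h"
    using eq by (simp_all add: with_proj_def app_iso_def)
  then have hom: "fst (iso_arcs h e) = ?f (fst e)" "snd (iso_arcs h e) = ?f (snd e)" if "e \<in> parcs G" for e
    using h that by (auto simp: pre_digraph.digraph_isomorphism_def)
  have inj: "inj_on ?f (pverts G)" using h by (simp add: pre_digraph.digraph_isomorphism_def)
  have "(u, v) \<in> parcs G \<longleftrightarrow> (?f u, ?f v) \<in> parcs H" if uv: "u \<in> pverts G" "v \<in> pverts G" for u v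
  proof
    assume e: "(u, v) \<in> parcs G"
    then have "iso_arcs h (u, v) = (?f u, ?f v)" using hom[OF e] by (simp add: prod_eq_iff)
    then show "(?f u, ?f v) \<in> parcs H" using e unfolding arcs by force
  next
    assume "(?f u, ?f v) \<in> parcs H"
    then obtain e where e: "e \<in> parcs G" "iso_arcs h e = (?f u, ?f v)" unfolding arcs by force
    then have "?f (fst e) = ?f u" "?f (snd e) = ?f v" using hom[OF e(1)] by simp_all
    moreover have "fst e \<in> pverts G" "snd e \<in> pverts G"
      using pair_graph_verts[OF assms(1), of "fst e" "snd e"] e(1) by auto
    ultimately have "fst e = u" "snd e = v" using inj uv by (auto dest: inj_onD)
    then show "(u, v) \<in> parcs G" using e(1) by auto
  qed
  then have "?iso ?f" using inj verts by (auto simp: bij_betw_def)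
  then show "\<exists>f. ?iso f" by (intro exI[of _ ?f])
next
  assume "\<exists>f. ?iso f"
  then obtain f where bij: "bij_betw f (pverts G) (pverts H)"
    and arc: "\<And>u v. u \<in> pverts G \<Longrightarrow> v \<in> pverts G \<Longrightarrow> (u, v) \<in> parcs G \<longleftrightarrow> (f u, f v) \<in> parcs H" by blast
  define h where "h = \<lparr>iso_verts = f, iso_arcs = map_prod f f, iso_head = snd, iso_tail = fst\<rparr>"
  have inj: "inj_on f (pverts G)" and img: "f ` pverts G = pverts H"
    using bij by (auto simp: bij_betw_def)
  interpret G: pair_graph G by fact
  have sub: "parcs G \<subseteq> pverts G \<times> pverts G" using pair_graph_verts[OF assms(1)] by auto
  have "inj_on (map_prod f f) (parcs G)"
    using map_prod_inj_on[OF inj inj] sub by (rule inj_on_subset)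
  then have "pre_digraph.digraph_isomorphism (with_proj G) h"
    using inj G.wf_digraph_axioms by (auto simp: pre_digraph.digraph_isomorphism_def h_def)
  moreover have "map_prod f f ` parcs G = parcs H"
  proof
    show "map_prod f f ` parcs G \<subseteq> parcs H" using arc sub by auto
    show "parcs H \<subseteq> map_prod f f ` parcs G"
    proof clarify
      fix a b assume ab: "(a, b) \<in> parcs H"
      then have "a \<in> f ` pverts G" "b \<in> f ` pverts G"
        using pair_graph_verts[OF assms(2) ab] img by auto
      then obtain u v where "u \<in> pverts G" "v \<in> pverts G" "a = f u" "b = f v" by blast
      then show "(a, b) \<in> map_prod f f ` parcs G"
        using arc ab by (intro image_eqI[of _ _ "(u, v)"]) auto
    qed
  qed
  then have "with_proj H = app_iso h (with_proj G)"
    using img by (simp add: with_proj_def app_iso_def h_def)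
  ultimately show "digraph_iso (with_proj G) (with_proj H)" unfolding digraph_iso_def by blast
qed

lemma digraph_iso_complement_iff:
  assumes "pair_graph F" "pair_graph H"
  shows "digraph_iso (with_proj (complement F)) (with_proj H) \<longleftrightarrow>
    (\<exists>f. bij_betw f (pverts F) (pverts H) \<and>
      (\<forall>u\<in>pverts F. \<forall>v\<in>pverts F. (u, v) \<in> parcs F \<longleftrightarrow> u \<noteq> v \<and> (f u, f v) \<notin> parcs H))"
  unfolding digraph_iso_with_proj_iff[OF pair_graph_complement[OF assms(1)] assms(2)]
  using pair_graph_irrefl[OF assms(1)] pair_graph_irrefl[OF assms(2)]
  by (intro arg_cong[of _ _ Ex] ext conj_cong ball_cong) (auto simp: complement_def)

lemma pair_graph_path_P4: "pair_graph path_P4"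
  by (rule pair_graphI) (auto simp: path_P4_def)

lemma pair_graph_turan_graph: "pair_graph (turan_graph n k)"
  by (rule pair_graphI) (auto simp: turan_graph_def)

text \<open>
  The complement of the path \<open>a b c d\<close> is the path \<open>b d a c\<close>; this is where
  the order of the vertices in both directions of the proof comes from.
\<close>

lemma digraph_iso_P4_iff:
  assumes "pair_graph F"
  shows "digraph_iso (with_proj (complement F)) (with_proj path_P4) \<longleftrightarrow>
    (\<exists>a b c d. four_vertex_path F a b c d)"
proof
  assume "digraph_iso (with_proj (complement F)) (with_proj path_P4)"
  then obtain f where bij: "bij_betw f (pverts F) {0, 1, 2, 3::nat}"
    and arc: "\<And>u v. u \<in> pverts F \<Longrightarrow> v \<in> pverts F \<Longrightarrow> (u, v) \<in> parcs F \<longleftrightarrow>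
      u \<noteq> v \<and> (f u, f v) \<notin> {(0, 1), (1, 0), (1, 2), (2, 1), (2, 3), (3, 2)}"
    unfolding digraph_iso_complement_iff[OF assms pair_graph_path_P4] by (auto simp: path_P4_def)
  define g where "g = inv_into (pverts F) f"
  have g: "bij_betw g {0, 1, 2, 3} (pverts F)" unfolding g_def using bij by (rule bij_betw_inv_into)
  then have V: "pverts F = {g 1, g 3, g 0, g 2}" and inj: "inj_on g {0, 1, 2, 3}"
    by (auto simp: bij_betw_def)
  have dist: "distinct [g 1, g 3, g 0, g 2]" using inj by (auto simp: inj_on_def)
  have f: "f (g i) = i" if "i \<in> {0, 1, 2, 3}" for i
    unfolding g_def using bij that by (metis bij_betw_def f_inv_into_f)
  have f': "f (g 0) = 0" "f (g 1) = 1" "f (g 2) = 2" "f (g 3) = 3" using f by auto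
  have "parcs F = {(g 1, g 3), (g 3, g 1), (g 3, g 0), (g 0, g 3), (g 0, g 2), (g 2, g 0)}" (is "_ = ?E")
  proof (rule set_eqI)
    fix e :: "'a \<times> 'a"
    obtain u v where e: "e = (u, v)" by (cases e)
    show "e \<in> parcs F \<longleftrightarrow> e \<in> ?E"
    proof (cases "u \<in> pverts F \<and> v \<in> pverts F")
      case True
      then have uv: "u \<in> {g 1, g 3, g 0, g 2}" "v \<in> {g 1, g 3, g 0, g 2}" using V by auto
      show ?thesis
        unfolding e arc[OF conjunct1[OF True] conjunct2[OF True]]
        using uv by (elim insertE emptyE) (use dist f' in auto)
    next
      case False
      then have "e \<notin> parcs F" using pair_graph_verts[OF assms] e by blast
      moreover have "e \<notin> ?E" using False V e by auto
      ultimately show ?thesis by simp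
    qed
  qed
  then have "four_vertex_path F (g 1) (g 3) (g 0) (g 2)"
    unfolding four_vertex_path_def using dist V by simp
  then show "\<exists>a b c d. four_vertex_path F a b c d" by blast
next
  assume "\<exists>a b c d. four_vertex_path F a b c d"
  then obtain a b c d where dist: "distinct [a, b, c, d]" and V: "pverts F = {a, b, c, d}"
    and E: "parcs F = {(a, b), (b, a), (b, c), (c, b), (c, d), (d, c)}"
    unfolding four_vertex_path_def by blast
  define f :: "'a \<Rightarrow> nat" where "f = (\<lambda>_. 0)(d := 1, a := 2, c := 3)"
  have f: "f a = 2" "f b = 0" "f c = 3" "f d = 1" using dist by (auto simp: f_def)
  have "bij_betw f (pverts F) (pverts path_P4)"
    using f by (auto simp: bij_betw_def inj_on_def V path_P4_def)
  moreover have "\<forall>u\<in>pverts F. \<forall>v\<in>pverts F. (u, v) \<in> parcs F \<longleftrightarrow> u \<noteq> v \<and> (f u, f v) \<notin> parcs path_P4"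
    unfolding V E path_P4_def using f dist by auto
  ultimately show "digraph_iso (with_proj (complement F)) (with_proj path_P4)"
    unfolding digraph_iso_complement_iff[OF assms pair_graph_path_P4] by blast
qed

lemma digraph_iso_turan_iff:
  assumes "pair_graph F"
  shows "digraph_iso (with_proj (complement F)) (with_proj (turan_graph n k)) \<longleftrightarrow>
    (\<exists>f. bij_betw f (pverts F) {..<n} \<and>
      (\<forall>u\<in>pverts F. \<forall>v\<in>pverts F. (u, v) \<in> parcs F \<longleftrightarrow> u \<noteq> v \<and> f u mod k = f v mod k))"
proof -
  have eq: "(\<forall>u\<in>pverts F. \<forall>v\<in>pverts F. (u, v) \<in> parcs F \<longleftrightarrow> u \<noteq> v \<and> (f u, f v) \<notin> parcs (turan_graph n k)) \<longleftrightarrow>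
    (\<forall>u\<in>pverts F. \<forall>v\<in>pverts F. (u, v) \<in> parcs F \<longleftrightarrow> u \<noteq> v \<and> f u mod k = f v mod k)"
    if "bij_betw f (pverts F) {..<n}" for f
  proof -
    have "f u < n" if "u \<in> pverts F" for u using \<open>bij_betw f _ _\<close> that by (auto simp: bij_betw_def)
    then show ?thesis by (auto simp: turan_graph_def)
  qed
  have verts: "pverts (turan_graph n k) = {..<n}" by (simp add: turan_graph_def)
  show ?thesis
    unfolding digraph_iso_complement_iff[OF assms pair_graph_turan_graph] verts
    by (intro ex_cong1 conj_cong refl eq)
qed

lemma card_turan_part_even:
  fixes l r :: nat
  assumes "r < l" shows "card {i. i < 2 * l \<and> i mod l = r} = 2"
  using card_turan_part[OF assms, of "2 * l"] assms by (simp add: turan_graph_def)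

lemma card_turan_part_odd:
  fixes l r :: nat
  assumes "r < l" shows "card {i. i < 2 * l - 1 \<and> i mod l = r} = (if r = l - 1 then 1 else 2)"
proof -
  have n: "2 * l - 1 = (l - 1) + 1 * l" using assms by simp
  have "(2 * l - 1) div l = 1" "(2 * l - 1) mod l = l - 1"
    unfolding n using assms by (subst div_mult_self1 mod_mult_self1; simp)+
  then show ?thesis using card_turan_part[OF assms, of "2 * l - 1"] assms by (auto simp: turan_graph_def)
qed

text \<open>
  The residue class of \<open>f u\<close> modulo \<open>l\<close> consists of the images of
  \<open>u\<close> and its neighbours in \<open>F\<close>. Classes have one or two elements, and at most
  the last of them, \<open>l - 1\<close>, is a singleton.
\<close>

lemma turan_colouring_imp_matching:
  fixes l n :: nat
  assumes "pair_graph F" "l \<ge> 2" "n = 2 * l \<or> n = 2 * l - 1" "bij_betw f (pverts F) {..<n}"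
    and adj: "\<And>u v. u \<in> pverts F \<Longrightarrow> v \<in> pverts F \<Longrightarrow> (u, v) \<in> parcs F \<longleftrightarrow> u \<noteq> v \<and> f u mod l = f v mod l"
  shows "matching_with_at_most_one_free_vertex F" "parcs F \<noteq> {}" "parcs (complement F) \<noteq> {}"
proof -
  have inj: "inj_on f (pverts F)" and img: "f ` pverts F = {..<n}"
    using assms(4) by (auto simp: bij_betw_def)
  have part: "card {i. i < n \<and> i mod l = r} = (if r = l - 1 \<and> n = 2 * l - 1 then 1 else 2)" if "r < l" for r
    using assms(3) card_turan_part_even[OF that] card_turan_part_odd[OF that] that assms(2)
    by (elim disjE) auto
  have degree: "Suc (card (neighbours F u)) = card {i. i < n \<and> i mod l = f u mod l}"
    if u: "u \<in> pverts F" for u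
  proof -
    have "insert u (neighbours F u) = {v \<in> pverts F. f v mod l = f u mod l}"
    proof (rule set_eqI)
      fix v
      show "v \<in> insert u (neighbours F u) \<longleftrightarrow> v \<in> {v \<in> pverts F. f v mod l = f u mod l}"
        using adj[OF u, of v] u pair_graph_verts(2)[OF assms(1), of u v]
        by (cases "v \<in> pverts F") auto
    qed
    moreover have "f ` {v \<in> pverts F. f v mod l = f u mod l} = {i. i < n \<and> i mod l = f u mod l}"
    proof -
      have "f ` {v \<in> pverts F. f v mod l = f u mod l} = {i \<in> f ` pverts F. i mod l = f u mod l}" by blast
      then show ?thesis unfolding img by simp
    qed
    ultimately have "f ` insert u (neighbours F u) = {i. i < n \<and> i mod l = f u mod l}" by simp
    moreover have "inj_on f (insert u (neighbours F u))"
      using u pair_graph_verts(2)[OF assms(1), of u] by (intro inj_on_subset[OF inj]) auto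
    ultimately have "card (insert u (neighbours F u)) = card {i. i < n \<and> i mod l = f u mod l}"
      by (metis card_image)
    then show ?thesis using finite_neighbours[OF assms(1), of u] pair_graph_irrefl[OF assms(1), of u] by simp
  qed
  have uniq: "y = z" if "(x, y) \<in> parcs F" "(x, z) \<in> parcs F" for x y z
  proof -
    have x: "x \<in> pverts F" using pair_graph_verts[OF assms(1) that(1)] by simp
    have "card (neighbours F x) \<le> Suc 0"
      using degree[OF x] part[of "f x mod l"] assms(2) by (simp split: if_splits)
    then show ?thesis using that card_le_Suc0_iff_eq[OF finite_neighbours[OF assms(1)]] by auto
  qed
  have free: "f x mod l = l - 1" if "x \<in> pverts F" "neighbours F x = {}" for x
  proof -
    have "card (neighbours F x) = 0" by (simp only: that(2) card.empty)
    moreover have "f x mod l < l" using assms(2) by simp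
    ultimately have "Suc 0 = (if f x mod l = l - 1 \<and> n = 2 * l - 1 then 1 else 2)"
      using degree[OF that(1)] unfolding part[OF \<open>f x mod l < l\<close>] by argo
    then show ?thesis by (metis numeral_2_eq_2 n_not_Suc_n)
  qed
  have "x = y" if "x \<in> pverts F" "y \<in> pverts F" "neighbours F x = {}" "neighbours F y = {}" for x y
    using adj[OF that(1,2)] free[OF that(1,3)] free[OF that(2,4)] that(3) by auto
  then show "matching_with_at_most_one_free_vertex F"
    using uniq unfolding matching_with_at_most_one_free_vertex_def by blast
  \<comment> \<open>The numbers \<open>0\<close> and \<open>l\<close> are congruent, \<open>0\<close>
    and \<open>1\<close> are not.\<close>
  have "0 < n" "1 < n" "l < n" using assms(2,3) by auto
  then have "0 \<in> f ` pverts F" "1 \<in> f ` pverts F" "l \<in> f ` pverts F" using img by auto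
  then obtain a b c where V: "a \<in> pverts F" "b \<in> pverts F" "c \<in> pverts F"
    and f: "f a = 0" "f b = 1" "f c = l" by (metis imageE)
  have "a \<noteq> c" "a \<noteq> b" using f assms(2) by auto
  then have "(a, c) \<in> parcs F" "(a, b) \<in> parcs (complement F)"
    using adj V f assms(2) by (auto simp: complement_def)
  then show "parcs F \<noteq> {}" "parcs (complement F) \<noteq> {}" by auto
qed

text \<open>
  Bijections between corresponding fibres are glued together.
\<close>

lemma bij_betw_respecting_fibres:
  assumes "finite V" "finite W" "c ` V \<subseteq> K" "d ` W \<subseteq> K"
    and "\<And>k. k \<in> K \<Longrightarrow> card {v \<in> V. c v = k} = card {w \<in> W. d w = k}"
  obtains f where "bij_betw f V W" "\<And>v. v \<in> V \<Longrightarrow> d (f v) = c v"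
proof -
  have "\<forall>k\<in>K. \<exists>h. bij_betw h {v \<in> V. c v = k} {w \<in> W. d w = k}"
    using assms by (intro ballI finite_same_card_bij) auto
  then obtain h where h: "\<And>k. k \<in> K \<Longrightarrow> bij_betw (h k) {v \<in> V. c v = k} {w \<in> W. d w = k}" by metis
  define f where "f v = h (c v) v" for v
  have f: "f v \<in> W \<and> d (f v) = c v" if "v \<in> V" for v
  proof -
    have "f v \<in> {w \<in> W. d w = c v}"
      unfolding f_def using that assms(3) by (intro bij_betw_apply[OF h]) auto
    then show ?thesis by simp
  qed
  have "inj_on f V"
  proof (rule inj_onI)
    fix u v assume uv: "u \<in> V" "v \<in> V" "f u = f v"
    then have "c u = c v" using f by metis
    moreover from this uv(3) have "h (c v) u = h (c v) v" by (simp add: f_def)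
    moreover have "inj_on (h (c v)) {x \<in> V. c x = c v}"
      using h[of "c v"] uv(2) assms(3) by (auto simp: bij_betw_def)
    ultimately show "u = v" using uv(1,2) by (auto dest: inj_onD)
  qed
  moreover have "W \<subseteq> f ` V"
  proof
    fix w assume w: "w \<in> W"
    then have "h (d w) ` {v \<in> V. c v = d w} = {w' \<in> W. d w' = d w}"
      using h[of "d w"] assms(4) by (auto simp: bij_betw_def)
    then obtain v where "v \<in> V" "c v = d w" "w = h (d w) v" using w by force
    then show "w \<in> f ` V" by (intro image_eqI[of _ _ v]) (simp_all add: f_def)
  qed
  ultimately have "bij_betw f V W" using f by (auto simp: bij_betw_def)
  then show thesis using that f by blast
qed

text \<open>
  The parts, that is, the edges and the free vertex of the matching, are numbered by
  \<open>{..<l}\<close>. A free vertex receives the number \<open>l - 1\<close>, the residue that occurs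
  only once below \<open>2 * l - 1\<close>. Then part sizes agree with sizes of residue classes, and
  \<open>bij_betw_respecting_fibres\<close> applies.
\<close>

lemma matching_imp_turan_colouring:
  assumes "pair_graph F" "matching_with_at_most_one_free_vertex F" "parcs (complement F) \<noteq> {}"
  shows "\<exists>(l::nat) n f. l \<ge> 2 \<and> (n = 2 * l \<or> n = 2 * l - 1) \<and> bij_betw f (pverts F) {..<n} \<and>
    (\<forall>u\<in>pverts F. \<forall>v\<in>pverts F. (u, v) \<in> parcs F \<longleftrightarrow> u \<noteq> v \<and> f u mod l = f v mod l)"
proof -
  note sym = pair_graph_sym[OF assms(1)] and irr = pair_graph_irrefl[OF assms(1)]
  note verts = pair_graph_verts[OF assms(1)] and fin = pair_graph_finite[OF assms(1)]
  have uniq: "\<And>x y z. (x, y) \<in> parcs F \<Longrightarrow> (x, z) \<in> parcs F \<Longrightarrow> y = z"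
    and free: "\<And>x y. x \<in> pverts F \<Longrightarrow> y \<in> pverts F \<Longrightarrow> neighbours F x = {} \<Longrightarrow> neighbours F y = {} \<Longrightarrow> x = y"
    using assms(2) unfolding matching_with_at_most_one_free_vertex_def by blast+
  define part where "part v = insert v (neighbours F v)" for v
  define \<P> where "\<P> = part ` pverts F"
  have part_matched: "part v = {v, w}" if "(v, w) \<in> parcs F" for v w
    using that uniq[OF that] unfolding part_def by blast
  have part_eq: "part u = part v \<longleftrightarrow> u = v \<or> (u, v) \<in> parcs F" for u v
  proof
    assume "part u = part v"
    then have "u \<in> insert v (neighbours F v)" unfolding part_def by blast
    then show "u = v \<or> (u, v) \<in> parcs F" using sym by blast
  next
    assume "u = v \<or> (u, v) \<in> parcs F"
    then show "part u = part v" using part_matched[of u v] part_matched[of v u] sym by auto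
  qed
  have part_free: "neighbours F v = {}" if "card (part v) \<noteq> 2" for v
  proof (rule ccontr)
    assume "neighbours F v \<noteq> {}"
    then obtain w where w: "(v, w) \<in> parcs F" by auto
    then have "v \<noteq> w" using irr by auto
    then show False using that part_matched[OF w] by simp
  qed
  define l where "l = card \<P>"
  have finP: "finite \<P>" using fin by (simp add: \<P>_def)
  have "l \<ge> 2"
  proof -
    obtain x y where "x \<in> pverts F" "y \<in> pverts F" "x \<noteq> y" "(x, y) \<notin> parcs F"
      using assms(3) by (auto simp: complement_def)
    then have "part x \<in> \<P>" "part y \<in> \<P>" "part x \<noteq> part y" by (auto simp: \<P>_def part_eq)
    then have "\<not> card \<P> \<le> Suc 0" using card_le_Suc0_iff_eq[OF finP] by blast
    then show ?thesis by (simp add: l_def)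
  qed
  have "\<exists>n g. (n = 2 * l \<or> n = 2 * l - 1) \<and> bij_betw g \<P> {..<l} \<and>
      (\<forall>v\<in>pverts F. card (part v) = card {i. i < n \<and> i mod l = g (part v)})"
  proof (cases "\<exists>z\<in>pverts F. neighbours F z = {}")
    case False
    obtain g where g: "bij_betw g \<P> {..<l}"
      using ex_bij_betw_finite_nat[OF finP] by (auto simp: l_def atLeast0LessThan)
    have "card (part v) = card {i. i < 2 * l \<and> i mod l = g (part v)}" if "v \<in> pverts F" for v
    proof -
      have "g (part v) < l" using that g by (auto simp: \<P>_def bij_betw_def)
      moreover have "card (part v) = 2" using part_free[of v] False that by blast
      ultimately show ?thesis using card_turan_part_even by simp
    qed
    then show ?thesis using g by blast
  next
    case True
    then obtain z where z: "z \<in> pverts F" "neighbours F z = {}" by blast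
    have partz: "part z = {z}" using z by (simp add: part_def)
    have zP: "part z \<in> \<P>" using z by (simp add: \<P>_def)
    have "card (\<P> - {part z}) = l - 1" using zP by (simp add: l_def card_Diff_singleton)
    then obtain g where g: "bij_betw g (\<P> - {part z}) {..<l - 1}"
      using ex_bij_betw_finite_nat[of "\<P> - {part z}"] finP by (auto simp: atLeast0LessThan)
    let ?g = "g(part z := l - 1)"
    have "bij_betw ?g (\<P> - {part z}) {..<l - 1}"
      using g by (subst bij_betw_cong[of _ _ g]) auto
    then have "bij_betw ?g ((\<P> - {part z}) \<union> {part z}) ({..<l - 1} \<union> {l - 1})"
      by (rule bij_betw_combine) (auto simp: bij_betw_def)
    moreover have "(\<P> - {part z}) \<union> {part z} = \<P>" using zP by auto
    moreover have "{..<l - 1} \<union> {l - 1} = {..<l}" using \<open>l \<ge> 2\<close> by auto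
    ultimately have g': "bij_betw ?g \<P> {..<l}" by simp
    have "card (part v) = card {i. i < 2 * l - 1 \<and> i mod l = ?g (part v)}" if v: "v \<in> pverts F" for v
    proof (cases "v = z")
      case True
      then show ?thesis using card_turan_part_odd[of "l - 1" l] \<open>l \<ge> 2\<close> partz by simp
    next
      case False
      have "neighbours F v \<noteq> {}" using free[OF v z(1) _ z(2)] False by blast
      then have two: "card (part v) = 2" using part_free by blast
      have ne: "part v \<noteq> part z" using two partz by auto
      then have "part v \<in> \<P> - {part z}" using v by (simp add: \<P>_def)
      then have "g (part v) < l - 1" using g by (auto simp: bij_betw_def)
      then show ?thesis using card_turan_part_odd[of "g (part v)" l] ne two by simp
    qed
    then show ?thesis using g' by blast
  qed
  then obtain n g where n: "n = 2 * l \<or> n = 2 * l - 1" and g: "bij_betw g \<P> {..<l}"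
    and size: "\<And>v. v \<in> pverts F \<Longrightarrow> card (part v) = card {i. i < n \<and> i mod l = g (part v)}" by blast
  have g_eq: "g (part u) = g (part v) \<longleftrightarrow> part u = part v" if "u \<in> pverts F" "v \<in> pverts F" for u v
    using g that by (auto simp: bij_betw_def \<P>_def dest: inj_onD)
  have fibres: "card {v \<in> pverts F. g (part v) = k} = card {i \<in> {..<n}. i mod l = k}" if "k \<in> {..<l}" for k
  proof -
    have "k \<in> g ` \<P>" using that g by (simp add: bij_betw_def)
    then obtain u where u: "u \<in> pverts F" "k = g (part u)" by (auto simp: \<P>_def)
    have "{v \<in> pverts F. g (part v) = k} = part u"
      using u g_eq part_eq sym verts by (auto simp: part_def)
    then show ?thesis using size[OF u(1)] u(2) by simp
  qed
  obtain f where f: "bij_betw f (pverts F) {..<n}" "\<And>v. v \<in> pverts F \<Longrightarrow> f v mod l = g (part v)"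
  proof (rule bij_betw_respecting_fibres[OF fin _ _ _ fibres])
    show "(\<lambda>v. g (part v)) ` pverts F \<subseteq> {..<l}" using g by (auto simp: bij_betw_def \<P>_def)
    show "(\<lambda>i. i mod l) ` {..<n} \<subseteq> {..<l}" using \<open>l \<ge> 2\<close> by auto
  qed auto
  have "(u, v) \<in> parcs F \<longleftrightarrow> u \<noteq> v \<and> f u mod l = f v mod l" if "u \<in> pverts F" "v \<in> pverts F" for u v
    using f(2)[OF that(1)] f(2)[OF that(2)] g_eq[OF that] part_eq[of u v] irr by auto
  then show ?thesis using \<open>l \<ge> 2\<close> n f(1) by blast
qed

lemma digraph_iso_balanced_turan_iff:
  assumes "pair_graph F"
  shows "(\<exists>l::nat. l \<ge> 2 \<and>
      (digraph_iso (with_proj (complement F)) (with_proj (turan_graph (2 * l) l)) \<or>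
       digraph_iso (with_proj (complement F)) (with_proj (turan_graph (2 * l - 1) l)))) \<longleftrightarrow>
    matching_with_at_most_one_free_vertex F \<and> parcs F \<noteq> {} \<and> parcs (complement F) \<noteq> {}" (is "?L \<longleftrightarrow> ?R")
proof
  assume ?L
  then obtain l n where ln: "l \<ge> 2" "n = 2 * l \<or> n = 2 * l - 1"
    and "digraph_iso (with_proj (complement F)) (with_proj (turan_graph n l))" by blast
  then obtain f where "bij_betw f (pverts F) {..<n}"
    "\<And>u v. u \<in> pverts F \<Longrightarrow> v \<in> pverts F \<Longrightarrow> (u, v) \<in> parcs F \<longleftrightarrow> u \<noteq> v \<and> f u mod l = f v mod l"
    unfolding digraph_iso_turan_iff[OF assms] by blast
  from turan_colouring_imp_matching[OF assms ln this] show ?R by blast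
next
  assume ?R
  then obtain l n :: nat and f where ln: "l \<ge> 2" "n = 2 * l \<or> n = 2 * l - 1" and "bij_betw f (pverts F) {..<n} \<and>
    (\<forall>u\<in>pverts F. \<forall>v\<in>pverts F. (u, v) \<in> parcs F \<longleftrightarrow> u \<noteq> v \<and> f u mod l = f v mod l)"
    using matching_imp_turan_colouring[OF assms] by blast
  then have "digraph_iso (with_proj (complement F)) (with_proj (turan_graph n l))"
    unfolding digraph_iso_turan_iff[OF assms] by blast
  then show ?L using ln by blast
qed

theorem theorem1p5:
  fixes F G :: "'a pair_pre_digraph"
  assumes "undirected_forest F"
    and "G = complement F"
  shows "nontrivially_minimally_tough G \<longleftrightarrow>
    digraph_iso (with_proj G) (with_proj path_P4) \<or>
    (\<exists>l::nat. l \<ge> 2 \<and>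
      (digraph_iso (with_proj G) (with_proj (turan_graph (2 * l) l)) \<or>
       digraph_iso (with_proj G) (with_proj (turan_graph (2 * l - 1) l))))"
proof -
  note F = forest_pair_graph[OF assms(1)]
  have "nontrivially_minimally_tough (complement F) \<longleftrightarrow>
    (\<exists>a b c d. four_vertex_path F a b c d) \<or>
    matching_with_at_most_one_free_vertex F \<and> parcs F \<noteq> {} \<and> parcs (complement F) \<noteq> {}"
    using nontrivially_minimally_tough_imp_shape[OF assms(1)]
      matching_imp_nontrivially_minimally_tough[OF assms(1)]
      four_vertex_path_imp_nontrivially_minimally_tough[OF assms(1)]
      nontrivially_minimally_tough_complement_iff[OF assms(1)] by blast
  then show ?thesis
    unfolding assms(2) digraph_iso_P4_iff[OF F] digraph_iso_balanced_turan_iff[OF F] .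
qed

end
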